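(* Let $\mathbf{S}$ be a canonical single-parameter exponential family with open mean range $\mathbf{O}=(\underline{\mu},\overline{\mu})$ and divergence $d(\cdot,\cdot)$. Let $\nu\in\mathbf{S}$ have mean $\mu$, let $\mathcal{C}$ be a cost distribution with mean $0<\overline c<\infty$, let the cost budget satisfy $C_\delta\to\infty$ as $\delta\to0$, and let $\pi\in\hat\Pi^s_{\rm CI}$ be any stable policy, with limiting endpoints $\mu_L^\pi(\mu)\le\mu\le\mu_R^\pi(\mu)$. Then: (a) (No learning regime) If $\lim_{\delta\to0}\frac{C_\delta}{\log(1/\delta)}=0$, then $\mu_R^\pi(\mu)-\mu_L^\pi(\mu)=\overline\mu-\underline\mu$. Further, $\widehat\mu_L^\pi(\tau_\delta,\delta)\overset{p}{\to}\underline\mu$ and $\widehat\mu_R^\pi(\tau_\delta,\delta)\overset{p}{\to}\overline\mu$ as $\delta\to0$. (b) (Sufficient learning regime) If $\lim_{\delta\to0}\frac{C_\delta}{\log(1/\delta)}=k$ with $k\in(0,\infty)$, then $$\mu_R^\pi(\mu)-\mu_L^\pi(\mu)\ \ge\ \mu_R^*(\mu,k,\overline c)-\mu_L^*(\mu,k,\overline c),$$ where $\mu_L^*(\mu,k,\overline c)<\mu$ and $\mu_R^*(\mu,k,\overline c)>\mu$ uniquely solve $$d(\mu,\mu_R^*(\mu,k,\overline c))=d(\mu,\mu_L^*(\mu,k,\overline c))=\frac{\overline c}{k}.$$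
   Context: Exponential family. Fix a reference measure $\xi$ on $\mathbb{R}$. $\mathbf{S}=\{p_\theta:\theta\in\Theta\}$, with $\frac{dp_\theta}{d\xi}(x)=\exp(\theta x-b(\theta))$, where $\Theta=\{\theta\in\mathbb{R}:\int|x|e^{\theta x}\,d\xi(x)<\infty\}$ is assumed to be an open interval, and $b$ is a known, twice differentiable, strictly convex function. The mean of $p_\theta$ is $b'(\theta)$, strictly increasing in $\theta$; its inverse is $\mu\mapsto\theta(\mu)$. The set of means (the "support of the mean") is the open interval $\mathbf{O}=(\underline\mu,\overline\mu)$. For $\mu,\tilde\mu\in\mathbf{O}$, $d(\mu,\tilde\mu)=KL(p_{\theta(\mu)},p_{\theta(\tilde\mu)})=b(\theta(\tilde\mu))-b(\theta(\mu))-b'(\theta(\mu))(\theta(\tilde\mu)-\theta(\mu))$, where $KL$ is the Kullback–Leibler divergence. Random costs. $X_1,X_2,\dots$ are i.i.d. from $\nu$; the costs $c_1,c_2,\dots$ are i.i.d. from an unknown distribution $\mathcal{C}$ with positive support and mean $\overline c$, independent of the $X_i$. For a budget $C_\delta$, $\tau_\delta=\sup\{n\in\mathbb{Z}^+:\sum_{i=1}^nc_i\le C_\delta\}$ (with $\tau_\delta=0$ if the set is empty) is the maximum number of samples that can be collected. $\mathbb{P}_\nu$ denotes the joint law of samples and costs. Policies. A policy $\pi$ reports, for each $\delta\in(0,1)$, an interval $[\widehat\mu_L^\pi(\tau_\delta,\delta),\widehat\mu_R^\pi(\tau_\delta,\delta)]$ after observing $X_1,\dots,X_{\tau_\delta}$.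 $\hat\Pi_{\rm CI}$ is the set of policies such that for every $\nu\in\mathbf{S}$ with mean $\mu$ and every $\delta\in(0,1)$, $\mathbb{P}_\nu(\mu\in[\widehat\mu_L^\pi(\tau_\delta,\delta),\widehat\mu_R^\pi(\tau_\delta,\delta)])\ge1-\delta$. Stability. Let $C_\delta\to\infty$ as $\delta\to0$. For a given $\nu$ with mean $\mu$, a policy $\pi\in\hat\Pi_{\rm CI}$ is stable if, as $\delta\to0$, under $\mathbb{P}_\nu$, $\widehat\mu_L^\pi(\tau_\delta,\delta)\overset{p}{\to}\mu_L^\pi(\mu)$ and $\widehat\mu_R^\pi(\tau_\delta,\delta)\overset{p}{\to}\mu_R^\pi(\mu)$, where $\mu_L^\pi(\mu)\le\mu$ and $\mu_R^\pi(\mu)\ge\mu$ are constants ($\infty$ and $-\infty$ included). $\hat\Pi^s_{\rm CI}$ is the set of stable policies in $\hat\Pi_{\rm CI}$.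
   Formalization: In (a), equality and convergence are for policies reporting within the closure of O (for all others: limits at or beyond its ends). In (b), each endpoint solution is claimed to exist uniquely only if d(μ,·) reaches c̄/k on that side; otherwise the end of O replaces it in the inequality. *)

theory Defs
  imports "HOL-Probability.Probability"
begin

subsection \<open>One-parameter exponential families\<close>

definition param_space :: "real measure \<Rightarrow> real set" where
  "param_space \<xi> = {\<theta>. (\<integral>\<^sup>+x. ennreal (\<bar>x\<bar> * exp (\<theta> * x)) \<partial>\<xi>) < \<infinity>}"

definition exp_fam_member :: "real measure \<Rightarrow> (real \<Rightarrow> real) \<Rightarrow> real \<Rightarrow> real measure" where
  "exp_fam_member \<xi> b \<theta> = density \<xi> (\<lambda>x. ennreal (exp (\<theta> * x - b \<theta>)))"

definition strictly_convex_on :: "real set \<Rightarrow> (real \<Rightarrow> real) \<Rightarrow> bool" where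
  "strictly_convex_on S f \<longleftrightarrow>
     (\<forall>x\<in>S. \<forall>y\<in>S. \<forall>t\<in>{0<..<1}. x \<noteq> y \<longrightarrow>
        f ((1 - t) * x + t * y) < (1 - t) * f x + t * f y)"

(* Requiring the members to be probability measures forces
   b \<theta> = ln (\<integral> exp (\<theta> x) d\<xi>) on the parameter space, and makes \<xi> sigma-finite. *)
definition exponential_family :: "real measure \<Rightarrow> (real \<Rightarrow> real) \<Rightarrow> bool" where
  "exponential_family \<xi> b \<longleftrightarrow>
     sets \<xi> = sets borel \<and>
     open (param_space \<xi>) \<and> is_interval (param_space \<xi>) \<and>
     (\<forall>\<theta>\<in>param_space \<xi>. prob_space (exp_fam_member \<xi> b \<theta>)) \<and>
     (\<forall>\<theta>\<in>param_space \<xi>. b differentiable (at \<theta>) \<and> deriv b differentiable (at \<theta>)) \<and>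
     strictly_convex_on (param_space \<xi>) b"

definition exp_fam :: "real measure \<Rightarrow> (real \<Rightarrow> real) \<Rightarrow> real measure set" where
  "exp_fam \<xi> b = exp_fam_member \<xi> b ` param_space \<xi>"

definition mean :: "real measure \<Rightarrow> real" where
  "mean \<nu> = (\<integral>x. x \<partial>\<nu>)"

definition mean_range :: "real measure \<Rightarrow> (real \<Rightarrow> real) \<Rightarrow> real set" where
  "mean_range \<xi> b = mean ` exp_fam \<xi> b"

definition param_of_mean :: "real measure \<Rightarrow> (real \<Rightarrow> real) \<Rightarrow> real \<Rightarrow> real" where
  "param_of_mean \<xi> b = the_inv_into (param_space \<xi>) (deriv b)"

(* KL_divergence takes the reference measure first: KL_divergence (exp 1) Q P is the
   divergence KL(P, Q) = \<integral> ln (dP/dQ) dP in nats. *)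
definition mean_divergence :: "real measure \<Rightarrow> (real \<Rightarrow> real) \<Rightarrow> real \<Rightarrow> real \<Rightarrow> real" where
  "mean_divergence \<xi> b \<mu> \<mu>' =
     KL_divergence (exp 1)
       (exp_fam_member \<xi> b (param_of_mean \<xi> b \<mu>'))
       (exp_fam_member \<xi> b (param_of_mean \<xi> b \<mu>))"


subsection \<open>Samples, costs and the number of affordable samples\<close>

definition cost_distribution :: "real measure \<Rightarrow> real \<Rightarrow> bool" where
  "cost_distribution \<C> c \<longleftrightarrow>
     prob_space \<C> \<and> sets \<C> = sets borel \<and> (AE x in \<C>. 0 < x) \<and>
     integrable \<C> (\<lambda>x. x) \<and> mean \<C> = c"

(* Outcomes are pairs (x, c) of sequences, indexed from 0:
   x i is the (i+1)-st sample and c i the (i+1)-st cost. *)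
definition joint_law :: "real measure \<Rightarrow> real measure \<Rightarrow> ((nat \<Rightarrow> real) \<times> (nat \<Rightarrow> real)) measure" where
  "joint_law \<nu> \<C> = (\<Pi>\<^sub>M i\<in>UNIV. \<nu>) \<Otimes>\<^sub>M (\<Pi>\<^sub>M i\<in>UNIV. \<C>)"

(* On nat, Sup {} = 0. For an unbounded set Sup is a fixed unspecified number; for positive
   i.i.d. costs this happens with probability 0. *)
definition num_samples :: "real \<Rightarrow> (nat \<Rightarrow> real) \<Rightarrow> nat" where
  "num_samples B c = Sup {n. 0 < n \<and> (\<Sum>i<n. c i) \<le> B}"


subsection \<open>Confidence interval policies\<close>

(* The reported endpoints, as functions of the number n of samples, the level \<delta>, and the
   samples themselves, given as an element of the product space over {..<n}. *)
record policy =
  lower_end :: "nat \<Rightarrow> real \<Rightarrow> (nat \<Rightarrow> real) \<Rightarrow> ereal"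
  upper_end :: "nat \<Rightarrow> real \<Rightarrow> (nat \<Rightarrow> real) \<Rightarrow> ereal"

definition measurable_policy :: "policy \<Rightarrow> bool" where
  "measurable_policy \<pi> \<longleftrightarrow>
     (\<forall>n. \<forall>\<delta>\<in>{0<..<1}.
        lower_end \<pi> n \<delta> \<in> borel_measurable (\<Pi>\<^sub>M i\<in>{..<n}. borel) \<and>
        upper_end \<pi> n \<delta> \<in> borel_measurable (\<Pi>\<^sub>M i\<in>{..<n}. borel))"

definition reported_lower ::
  "policy \<Rightarrow> (real \<Rightarrow> real) \<Rightarrow> real \<Rightarrow> (nat \<Rightarrow> real) \<times> (nat \<Rightarrow> real) \<Rightarrow> ereal" where
  "reported_lower \<pi> B \<delta> \<omega> =
     (let n = num_samples (B \<delta>) (snd \<omega>) in lower_end \<pi> n \<delta> (restrict (fst \<omega>) {..<n}))"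

definition reported_upper ::
  "policy \<Rightarrow> (real \<Rightarrow> real) \<Rightarrow> real \<Rightarrow> (nat \<Rightarrow> real) \<times> (nat \<Rightarrow> real) \<Rightarrow> ereal" where
  "reported_upper \<pi> B \<delta> \<omega> =
     (let n = num_samples (B \<delta>) (snd \<omega>) in upper_end \<pi> n \<delta> (restrict (fst \<omega>) {..<n}))"

definition CI_policies ::
  "real measure \<Rightarrow> (real \<Rightarrow> real) \<Rightarrow> real measure \<Rightarrow> (real \<Rightarrow> real) \<Rightarrow> policy set" where
  "CI_policies \<xi> b \<C> B =
     {\<pi>. measurable_policy \<pi> \<and>
       (\<forall>\<nu>\<in>exp_fam \<xi> b. \<forall>\<delta>\<in>{0<..<1}.
          measure (joint_law \<nu> \<C>)
            {\<omega>\<in>space (joint_law \<nu> \<C>).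
               ereal (mean \<nu>) \<in> {reported_lower \<pi> B \<delta> \<omega>..reported_upper \<pi> B \<delta> \<omega>}}
          \<ge> 1 - \<delta>)}"

(* Nothing in CI_policies prevents endpoints beyond the range of possible means. *)
definition reports_within :: "ereal \<Rightarrow> ereal \<Rightarrow> policy \<Rightarrow> bool" where
  "reports_within lo hi \<pi> \<longleftrightarrow>
     (\<forall>n. \<forall>\<delta>\<in>{0<..<1}. \<forall>x\<in>extensional {..<n}.
        lo \<le> lower_end \<pi> n \<delta> x \<and> upper_end \<pi> n \<delta> x \<le> hi)"

(* Convergence in probability to a constant as \<delta> tends to 0 from the right. For finite l the
   sets U may be taken to be the intervals (l - e, l + e); for l = \<infinity> they may be taken to be
   the rays above K for real K, similarly for -\<infinity>. *)
definition tendsto_in_prob :: "'a measure \<Rightarrow> (real \<Rightarrow> 'a \<Rightarrow> ereal) \<Rightarrow> ereal \<Rightarrow> bool" where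
  "tendsto_in_prob M Y l \<longleftrightarrow>
     (\<forall>U. open U \<longrightarrow> l \<in> U \<longrightarrow>
        ((\<lambda>\<delta>. measure M {\<omega>\<in>space M. Y \<delta> \<omega> \<in> U}) \<longlongrightarrow> 1) (at_right 0))"

definition stable_policy ::
  "real measure \<Rightarrow> real measure \<Rightarrow> (real \<Rightarrow> real) \<Rightarrow> policy \<Rightarrow> ereal \<Rightarrow> ereal \<Rightarrow> bool" where
  "stable_policy \<nu> \<C> B \<pi> \<mu>L \<mu>R \<longleftrightarrow>
     \<mu>L \<le> ereal (mean \<nu>) \<and> ereal (mean \<nu>) \<le> \<mu>R \<and>
     tendsto_in_prob (joint_law \<nu> \<C>) (reported_lower \<pi> B) \<mu>L \<and>
     tendsto_in_prob (joint_law \<nu> \<C>) (reported_upper \<pi> B) \<mu>R"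


subsection \<open>Limiting endpoints in the sufficient learning regime\<close>

definition solves_left :: "real measure \<Rightarrow> (real \<Rightarrow> real) \<Rightarrow> real \<Rightarrow> real \<Rightarrow> real \<Rightarrow> real \<Rightarrow> bool" where
  "solves_left \<xi> b \<mu> k c l \<longleftrightarrow>
     l \<in> mean_range \<xi> b \<and> l < \<mu> \<and> mean_divergence \<xi> b \<mu> l = c / k"

definition solves_right :: "real measure \<Rightarrow> (real \<Rightarrow> real) \<Rightarrow> real \<Rightarrow> real \<Rightarrow> real \<Rightarrow> real \<Rightarrow> bool" where
  "solves_right \<xi> b \<mu> k c r \<longleftrightarrow>
     r \<in> mean_range \<xi> b \<and> \<mu> < r \<and> mean_divergence \<xi> b \<mu> r = c / k"

(* The divergence from \<mu> may stay below c / k on one side of \<mu>: take \<xi> with density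
   exp (-x) / x^2 on [1, \<infinity>), whose log-partition function has a finite limit at the right end
   of the parameter space {..<1}. The equation then has no solution on that side, and the
   endpoint is taken to be the end of the mean range. *)
definition left_star ::
  "real measure \<Rightarrow> (real \<Rightarrow> real) \<Rightarrow> real \<Rightarrow> real \<Rightarrow> real \<Rightarrow> ereal" where
  "left_star \<xi> b \<mu> k c =
     (if \<exists>l. solves_left \<xi> b \<mu> k c l then ereal (THE l. solves_left \<xi> b \<mu> k c l)
      else (INF m\<in>mean_range \<xi> b. ereal m))"

definition right_star ::
  "real measure \<Rightarrow> (real \<Rightarrow> real) \<Rightarrow> real \<Rightarrow> real \<Rightarrow> real \<Rightarrow> ereal" where
  "right_star \<xi> b \<mu> k c =
     (if \<exists>r. solves_right \<xi> b \<mu> k c r then ereal (THE r. solves_right \<xi> b \<mu> k c r)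
      else (SUP m\<in>mean_range \<xi> b. ereal m))"

end

theory Submission
  imports Defs
begin

text \<open>
  Fix a family member \<open>\<nu>\<close> with mean \<open>\<mu>\<close> and another member \<open>\<nu>'\<close> with mean \<open>m\<close>. A valid policy
  misses \<open>m\<close> with probability at most \<open>\<delta>\<close> under \<open>\<nu>'\<close>. If its limiting interval under \<open>\<nu>\<close> did not
  contain \<open>m\<close>, then the event of missing \<open>m\<close> would have probability close to 1 under \<open>\<nu>\<close>. Telling
  the two laws apart this sharply needs a log-likelihood ratio of about \<open>ln (1 / \<delta>)\<close>, whereas the
  budget buys only about \<open>B \<delta> / c\<close> samples, each worth \<open>d(\<mu>, m)\<close> on average. Hence, when
  \<open>B \<delta> / ln (1 / \<delta>)\<close> tends to \<open>\<kappa>\<close>, every mean \<open>m\<close> with \<open>\<kappa> d(\<mu>, m) < c\<close> lies between the limiting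
  endpoints. For \<open>\<kappa> = 0\<close> these are all means; for \<open>\<kappa> = k > 0\<close> they are exactly the means on which
  the divergence is below \<open>c / k\<close>, and since \<open>d(\<mu>, \<cdot>)\<close> is continuous and strictly increasing away
  from \<open>\<mu>\<close>, they fill the open interval between \<open>left_star\<close> and \<open>right_star\<close>.

  The change of measure avoids laws of large numbers. A likelihood ratio \<open>L\<close> satisfies
  \<open>L \<le> exp t + exp (- \<eta> t) L powr (1 + \<eta>)\<close>, and the moment of order \<open>1 + \<eta>\<close> of an i.i.d. likelihood
  ratio factorises, so an event on \<open>n\<close> samples obeys an explicit bound (\<open>emeasure_PiM_density_le\<close>).
  As the costs are independent of the samples, this bound integrates over the random number of
  samples (\<open>random_prefix_density_le\<close>). That number rarely exceeds \<open>B \<delta> / c'\<close> for \<open>c' < c\<close>, by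
  a Chernoff bound with \<open>exp (- s x)\<close>, which needs only the first moment of the positive costs
  (\<open>prob_num_samples_gt_le\<close>). In an exponential family the moment of order \<open>1 + \<eta>\<close> is
  \<open>exp \<psi>\<close> with \<open>\<psi> / \<eta>\<close> tending to \<open>d(\<mu>, m)\<close> as \<open>\<eta>\<close> tends to 0 (\<open>exists_tilt\<close>). All three terms of the
  resulting bound vanish when \<open>\<kappa> d(\<mu>, m) < c\<close> (\<open>prefix_event_vanishes\<close>).

  The analytic facts on the family rest on one inequality: nonnegativity of the Kullback-Leibler
  divergence says that the mean of a member is a subgradient of \<open>b\<close> at its parameter
  (\<open>subgradient_mean\<close>). As \<open>b\<close> is differentiable, the mean is \<open>deriv b\<close>, with no
  differentiation under the integral sign.
\<close>

section \<open>Change of measure for a random number of samples\<close>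

lemma PiM_density_eq:
  fixes N :: "'a measure" and f :: "'a \<Rightarrow> ennreal"
  assumes N: "prob_space N" and f [measurable]: "f \<in> borel_measurable N"
    and P: "prob_space (density N f)" and I: "finite I"
  shows "PiM I (\<lambda>_. density N f) = density (PiM I (\<lambda>_. N)) (\<lambda>x. \<Prod>i\<in>I. f (x i))"
proof -
  interpret N: product_prob_space "\<lambda>_. N" I
    by (rule product_prob_spaceI) (rule N)
  interpret D: product_prob_space "\<lambda>_. density N f" I
    by (rule product_prob_spaceI) (rule P)
  show ?thesis
  proof (rule D.PiM_eqI[symmetric])
    show "sets (density (PiM I (\<lambda>_. N)) (\<lambda>x. \<Prod>i\<in>I. f (x i))) = sets (PiM I (\<lambda>_. density N f))"
      by (simp cong: sets_PiM_cong)
  next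
    fix A assume "\<And>i. i \<in> I \<Longrightarrow> A i \<in> sets (density N f)"
    then have A [measurable]: "\<And>i. i \<in> I \<Longrightarrow> A i \<in> sets N" by simp
    have box: "Pi\<^sub>E I A \<in> sets (PiM I (\<lambda>_. N))"
      using I A by (intro sets_PiM_I_finite) auto
    have "emeasure (density (PiM I (\<lambda>_. N)) (\<lambda>x. \<Prod>i\<in>I. f (x i))) (Pi\<^sub>E I A)
        = (\<integral>\<^sup>+x. (\<Prod>i\<in>I. f (x i)) * indicator (Pi\<^sub>E I A) x \<partial>PiM I (\<lambda>_. N))"
      using box by (subst emeasure_density) auto
    also have "\<dots> = (\<integral>\<^sup>+x. (\<Prod>i\<in>I. f (x i) * indicator (A i) (x i)) \<partial>PiM I (\<lambda>_. N))"
    proof (rule nn_integral_cong)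
      fix x assume "x \<in> space (PiM I (\<lambda>_. N))"
      then have "x \<in> extensional I" by (auto simp: space_PiM PiE_def)
      then have "indicator (Pi\<^sub>E I A) x = (\<Prod>i\<in>I. indicator (A i) (x i) :: ennreal)"
        using I by (auto simp: indicator_def PiE_def Pi_def)
      then show "(\<Prod>i\<in>I. f (x i)) * indicator (Pi\<^sub>E I A) x = (\<Prod>i\<in>I. f (x i) * indicator (A i) (x i))"
        by (simp add: prod.distrib)
    qed
    also have "\<dots> = (\<Prod>i\<in>I. \<integral>\<^sup>+y. f y * indicator (A i) y \<partial>N)"
      using I A by (intro N.product_nn_integral_prod) auto
    also have "\<dots> = (\<Prod>i\<in>I. emeasure (density N f) (A i))"
      using A by (intro prod.cong refl) (simp add: emeasure_density)
    finally show "emeasure (density (PiM I (\<lambda>_. N)) (\<lambda>x. \<Prod>i\<in>I. f (x i))) (Pi\<^sub>E I A)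
        = (\<Prod>i\<in>I. emeasure (density N f) (A i))" .
  qed (rule I)
qed

text \<open>
  Where \<open>L\<close> exceeds \<open>exp t\<close>, the factor \<open>(L / exp t) powr \<eta>\<close> is at least 1.
\<close>

lemma le_exp_plus_tilted_powr:
  fixes L t \<eta> :: real
  assumes "0 < L" "0 < \<eta>"
  shows "L \<le> exp t + exp (- \<eta> * t) * L powr (1 + \<eta>)"
proof (cases "L \<le> exp t")
  case False
  then have "exp t powr \<eta> \<le> L powr \<eta>"
    using assms by (intro powr_mono2) auto
  then have "exp (\<eta> * t) \<le> L powr \<eta>"
    by (simp add: powr_def)
  then have "exp (- \<eta> * t) * exp (\<eta> * t) * L \<le> exp (- \<eta> * t) * L powr \<eta> * L"
    using assms by (intro mult_right_mono mult_left_mono) auto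
  moreover have "L powr (1 + \<eta>) = L powr \<eta> * L"
    using assms by (simp add: powr_add)
  ultimately have "L \<le> exp (- \<eta> * t) * L powr (1 + \<eta>)"
    by (simp add: exp_minus mult.assoc)
  then show ?thesis by (smt (verit) exp_gt_zero)
qed (use assms in \<open>smt (verit) exp_ge_zero powr_ge_zero mult_nonneg_nonneg\<close>)

text \<open>
  The truncation inequality above is applied to the likelihood ratio of the product measures and
  integrated over \<open>A\<close>; in its second term the restriction to \<open>A\<close> is dropped, after which the
  integral factorises.
\<close>

lemma emeasure_PiM_density_le:
  fixes N :: "'a measure" and f :: "'a \<Rightarrow> real"
  assumes N: "prob_space N" and f [measurable]: "f \<in> borel_measurable N" and pos: "\<And>x. 0 < f x"
    and P: "prob_space (density N f)" and I: "finite I" and "0 < \<eta>"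
    and A: "A \<in> sets (PiM I (\<lambda>_. N))"
  shows "emeasure (PiM I (\<lambda>_. density N f)) A \<le>
     ennreal (exp t) * emeasure (PiM I (\<lambda>_. N)) A
     + ennreal (exp (- \<eta> * t)) * (\<integral>\<^sup>+x. ennreal (f x powr (1 + \<eta>)) \<partial>N) ^ card I"
proof -
  interpret N: product_prob_space "\<lambda>_. N" I
    by (rule product_prob_spaceI) (rule N)
  let ?L = "\<lambda>x. \<Prod>i\<in>I. f (x i)"
  have L: "0 < ?L x" for x using pos by (intro prod_pos) auto
  note A [measurable]
  have "emeasure (PiM I (\<lambda>_. density N f)) A = emeasure (density (PiM I (\<lambda>_. N)) (\<lambda>x. \<Prod>i\<in>I. ennreal (f (x i)))) A"
    using assms by (subst PiM_density_eq) auto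
  also have "\<dots> = (\<integral>\<^sup>+x. (\<Prod>i\<in>I. ennreal (f (x i))) * indicator A x \<partial>PiM I (\<lambda>_. N))"
    by (subst emeasure_density) auto
  also have "\<dots> = (\<integral>\<^sup>+x. ennreal (?L x) * indicator A x \<partial>PiM I (\<lambda>_. N))"
    using pos by (intro nn_integral_cong) (simp add: prod_ennreal less_imp_le)
  also have "\<dots> \<le> (\<integral>\<^sup>+x. ennreal (exp t) * indicator A x
      + ennreal (exp (- \<eta> * t)) * (\<Prod>i\<in>I. ennreal (f (x i) powr (1 + \<eta>))) \<partial>PiM I (\<lambda>_. N))"
  proof (rule nn_integral_mono)
    fix x
    have "(\<Prod>i\<in>I. ennreal (f (x i) powr (1 + \<eta>))) = ennreal (?L x powr (1 + \<eta>))"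
      using pos by (simp add: prod_ennreal prod_powr_distrib less_imp_le)
    moreover have "ennreal (?L x) \<le> ennreal (exp t) + ennreal (exp (- \<eta> * t)) * ennreal (?L x powr (1 + \<eta>))"
      using le_exp_plus_tilted_powr[OF L \<open>0 < \<eta>\<close>, of x t]
      by (simp add: ennreal_mult[symmetric] ennreal_plus[symmetric] del: ennreal_plus)
    ultimately show "ennreal (?L x) * indicator A x \<le> ennreal (exp t) * indicator A x
      + ennreal (exp (- \<eta> * t)) * (\<Prod>i\<in>I. ennreal (f (x i) powr (1 + \<eta>)))"
      by (auto simp: indicator_def)
  qed
  also have "\<dots> = ennreal (exp t) * emeasure (PiM I (\<lambda>_. N)) A
      + ennreal (exp (- \<eta> * t)) * (\<integral>\<^sup>+x. (\<Prod>i\<in>I. ennreal (f (x i) powr (1 + \<eta>))) \<partial>PiM I (\<lambda>_. N))"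
    by (simp add: nn_integral_add nn_integral_cmult nn_integral_cmult_indicator)
  also have "(\<integral>\<^sup>+x. (\<Prod>i\<in>I. ennreal (f (x i) powr (1 + \<eta>))) \<partial>PiM I (\<lambda>_. N))
      = (\<integral>\<^sup>+x. ennreal (f x powr (1 + \<eta>)) \<partial>N) ^ card I"
    using I by (subst N.product_nn_integral_prod) auto
  finally show ?thesis .
qed

text \<open>
  Given the second coordinate, the number of observed samples is fixed, so the event depends on
  finitely many coordinates and its probability is that under a finite product.
\<close>

lemma emeasure_pair_PiM_prefix:
  fixes P :: "'a measure" and Q :: "'b measure"
  assumes P: "prob_space P" and Q: "prob_space Q"
    and T [measurable]: "T \<in> measurable Q (count_space UNIV)"
    and A [measurable]: "\<And>n. A n \<in> sets (PiM {..<n::nat} (\<lambda>_. P))"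
  shows "emeasure (PiM UNIV (\<lambda>_. P) \<Otimes>\<^sub>M Q)
      {\<omega> \<in> space (PiM UNIV (\<lambda>_. P) \<Otimes>\<^sub>M Q). restrict (fst \<omega>) {..<T (snd \<omega>)} \<in> A (T (snd \<omega>))}
    = (\<integral>\<^sup>+c. emeasure (PiM {..<T c} (\<lambda>_. P)) (A (T c)) \<partial>Q)" (is "emeasure ?M ?E = _")
    and "{\<omega> \<in> space (PiM UNIV (\<lambda>_. P) \<Otimes>\<^sub>M Q). restrict (fst \<omega>) {..<T (snd \<omega>)} \<in> A (T (snd \<omega>))}
      \<in> sets (PiM UNIV (\<lambda>_. P) \<Otimes>\<^sub>M Q)"
proof -
  interpret P: product_prob_space "\<lambda>_. P" "UNIV :: nat set"
    by (rule product_prob_spaceI) (rule P)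
  interpret Q: prob_space Q by fact
  interpret PQ: pair_sigma_finite "PiM (UNIV :: nat set) (\<lambda>_. P)" Q ..
  have restr [measurable]: "(\<lambda>x. restrict x {..<n}) \<in> measurable (PiM UNIV (\<lambda>_. P)) (PiM {..<n::nat} (\<lambda>_. P))" for n
    by (rule measurable_restrict_subset) auto
  have "Measurable.pred ?M (\<lambda>\<omega>. restrict (fst \<omega>) {..<n} \<in> A n)" for n
    by measurable
  then have "Measurable.pred ?M (\<lambda>\<omega>. restrict (fst \<omega>) {..<T (snd \<omega>)} \<in> A (T (snd \<omega>)))"
    by (rule measurable_compose_countable[where g="\<lambda>\<omega>. T (snd \<omega>)"]) measurable
  then show E: "?E \<in> sets ?M"
    by measurable
  have "emeasure ?M ?E = (\<integral>\<^sup>+c. emeasure (PiM UNIV (\<lambda>_. P)) ((\<lambda>x. (x, c)) -` ?E) \<partial>Q)"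
    by (rule PQ.emeasure_pair_measure_alt2[OF E])
  also have "\<dots> = (\<integral>\<^sup>+c. emeasure (PiM {..<T c} (\<lambda>_. P)) (A (T c)) \<partial>Q)"
  proof (rule nn_integral_cong)
    fix c assume c: "c \<in> space Q"
    have "emeasure (PiM {..<T c} (\<lambda>_. P)) (A (T c))
      = emeasure (distr (PiM UNIV (\<lambda>_. P)) (PiM {..<T c} (\<lambda>_. P)) (\<lambda>x. restrict x {..<T c})) (A (T c))"
      by (subst P.distr_PiM_restrict_finite) auto
    also have "\<dots> = emeasure (PiM UNIV (\<lambda>_. P)) ((\<lambda>x. restrict x {..<T c}) -` A (T c) \<inter> space (PiM UNIV (\<lambda>_. P)))"
      by (rule emeasure_distr) auto
    also have "(\<lambda>x. restrict x {..<T c}) -` A (T c) \<inter> space (PiM UNIV (\<lambda>_. P)) = (\<lambda>x. (x, c)) -` ?E"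
      using c by (auto simp: space_pair_measure)
    finally show "emeasure (PiM UNIV (\<lambda>_. P)) ((\<lambda>x. (x, c)) -` ?E) = emeasure (PiM {..<T c} (\<lambda>_. P)) (A (T c))" ..
  qed
  finally show "emeasure ?M ?E = (\<integral>\<^sup>+c. emeasure (PiM {..<T c} (\<lambda>_. P)) (A (T c)) \<partial>Q)" .
qed

text \<open>
  The number \<open>T\<close> of observed samples is independent of the samples. Where \<open>T\<close> is at most \<open>n\<close>, the
  bound for a fixed number of samples applies, with its moment term at most \<open>g ^ n\<close> because
  \<open>1 \<le> g\<close>; where \<open>T\<close> exceeds \<open>n\<close>, the conditional probability is bounded by 1.
\<close>

lemma random_prefix_density_le:
  fixes N :: "'a measure" and Q :: "'b measure" and f :: "'a \<Rightarrow> real"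
  assumes N: "prob_space N" and f [measurable]: "f \<in> borel_measurable N" and pos: "\<And>x. 0 < f x"
    and P: "prob_space (density N f)" and Q: "prob_space Q" and "0 < \<eta>"
    and T [measurable]: "T \<in> measurable Q (count_space UNIV)"
    and A: "\<And>n. A n \<in> sets (PiM {..<n::nat} (\<lambda>_. N))"
    and G: "(\<integral>\<^sup>+x. ennreal (f x powr (1 + \<eta>)) \<partial>N) \<le> ennreal g" "1 \<le> g"
  defines "E \<equiv> \<lambda>M. {\<omega> \<in> space (PiM UNIV (\<lambda>_. M) \<Otimes>\<^sub>M Q). restrict (fst \<omega>) {..<T (snd \<omega>)} \<in> A (T (snd \<omega>))}"
  shows "measure (PiM UNIV (\<lambda>_. density N f) \<Otimes>\<^sub>M Q) (E (density N f)) \<le>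
     exp t * measure (PiM UNIV (\<lambda>_. N) \<Otimes>\<^sub>M Q) (E N) + exp (- \<eta> * t) * g ^ n
     + measure Q {c \<in> space Q. n < T c}"
proof -
  interpret N: product_prob_space "\<lambda>_. N" "UNIV :: nat set"
    by (rule product_prob_spaceI) (rule N)
  interpret D: product_prob_space "\<lambda>_. density N f" "UNIV :: nat set"
    by (rule product_prob_spaceI) (rule P)
  interpret Q: prob_space Q by fact
  interpret NQ: pair_prob_space "PiM (UNIV :: nat set) (\<lambda>_. N)" Q ..
  interpret DQ: pair_prob_space "PiM (UNIV :: nat set) (\<lambda>_. density N f)" Q ..
  have sets_eq: "sets (PiM {..<n} (\<lambda>_. density N f)) = sets (PiM {..<n} (\<lambda>_. N))" for n :: nat
    by (simp cong: sets_PiM_cong)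
  let ?p = "\<lambda>M c. emeasure (PiM {..<T c} (\<lambda>_. M)) (A (T c))"
  have [measurable]: "(\<lambda>c. ?p M c) \<in> borel_measurable Q" for M
    by (rule measurable_compose[OF T]) simp
  have "emeasure (PiM UNIV (\<lambda>_. density N f) \<Otimes>\<^sub>M Q) (E (density N f)) = (\<integral>\<^sup>+c. ?p (density N f) c \<partial>Q)"
    unfolding E_def using A by (intro emeasure_pair_PiM_prefix(1) P Q T) (simp add: sets_eq)
  also have "\<dots> \<le> (\<integral>\<^sup>+c. ennreal (exp t) * ?p N c + ennreal (exp (- \<eta> * t) * g ^ n)
       + indicator {c \<in> space Q. n < T c} c \<partial>Q)"
  proof (rule nn_integral_mono)
    fix c assume c: "c \<in> space Q"
    show "?p (density N f) c \<le> ennreal (exp t) * ?p N c + ennreal (exp (- \<eta> * t) * g ^ n)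
       + indicator {c \<in> space Q. n < T c} c"
    proof (cases "n < T c")
      case True
      interpret DT: prob_space "PiM {..<T c} (\<lambda>_. density N f)"
        by (intro prob_space_PiM P)
      have "?p (density N f) c \<le> 1" by (rule DT.emeasure_le_1)
      with True c show ?thesis by (simp add: add_increasing)
    next
      case False
      have "(\<integral>\<^sup>+x. ennreal (f x powr (1 + \<eta>)) \<partial>N) ^ T c \<le> ennreal g ^ T c"
        by (intro power_mono G) simp
      also have "\<dots> \<le> ennreal g ^ n"
        using G False by (intro power_increasing) auto
      finally have le: "(\<integral>\<^sup>+x. ennreal (f x powr (1 + \<eta>)) \<partial>N) ^ T c \<le> ennreal (g ^ n)"
        using G by (simp add: ennreal_power)
      have "?p (density N f) c \<le> ennreal (exp t) * ?p N c
        + ennreal (exp (- \<eta> * t)) * (\<integral>\<^sup>+x. ennreal (f x powr (1 + \<eta>)) \<partial>N) ^ card {..<T c}"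
        by (intro emeasure_PiM_density_le N f pos P A \<open>0 < \<eta>\<close>) simp
      also have "\<dots> \<le> ennreal (exp t) * ?p N c + ennreal (exp (- \<eta> * t)) * ennreal (g ^ n)"
        using le by (intro add_left_mono mult_left_mono) auto
      finally show ?thesis
        using G by (simp add: ennreal_mult[symmetric] add_increasing2)
    qed
  qed
  also have "\<dots> = ennreal (exp t) * (\<integral>\<^sup>+c. ?p N c \<partial>Q) + ennreal (exp (- \<eta> * t) * g ^ n)
       + emeasure Q {c \<in> space Q. n < T c}"
    by (simp add: nn_integral_add nn_integral_cmult Q.emeasure_space_1)
  also have "(\<integral>\<^sup>+c. ?p N c \<partial>Q) = emeasure (PiM UNIV (\<lambda>_. N) \<Otimes>\<^sub>M Q) (E N)"
    unfolding E_def by (intro emeasure_pair_PiM_prefix(1)[symmetric] N Q T A)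
  finally have "ennreal (measure (PiM UNIV (\<lambda>_. density N f) \<Otimes>\<^sub>M Q) (E (density N f)))
    \<le> ennreal (exp t * measure (PiM UNIV (\<lambda>_. N) \<Otimes>\<^sub>M Q) (E N) + exp (- \<eta> * t) * g ^ n
       + measure Q {c \<in> space Q. n < T c})"
    using G by (simp add: NQ.emeasure_eq_measure DQ.emeasure_eq_measure Q.emeasure_eq_measure
        ennreal_mult)
  then show ?thesis
    using G by (subst (asm) ennreal_le_iff) auto
qed

section \<open>The number of affordable samples\<close>

lemma measurable_num_samples:
  assumes "sets \<C> = sets borel"
  shows "num_samples B \<in> measurable (PiM UNIV (\<lambda>_. \<C>)) (count_space UNIV)"
proof -
  have [measurable]: "(\<lambda>c. c i) \<in> borel_measurable (PiM UNIV (\<lambda>_. \<C>))" for i :: nat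
    using measurable_component_singleton[of i UNIV "\<lambda>_. \<C>"]
    by (simp add: measurable_cong_sets[OF refl assms])
  show ?thesis
    unfolding num_samples_def by measurable
qed

text \<open>
  The difference quotients \<open>(1 - exp (- s x)) / s\<close> are dominated by \<open>x\<close> and tend to \<open>x\<close> as \<open>s\<close> tends to 0,
  so their integrals tend to the mean cost. Some quotient therefore has integral above \<open>c'\<close>, and
  \<open>1 - s c' \<le> exp (- s c')\<close> finishes the argument.
\<close>

lemma cost_laplace_transform_lt:
  assumes cost: "cost_distribution \<C> c" and "c' < c"
  obtains s where "0 < s" "(\<integral>x. exp (- s * x) \<partial>\<C>) < exp (- s * c')"
proof -
  interpret C: prob_space \<C> using cost by (simp add: cost_distribution_def)
  have [measurable_cong, simp]: "sets \<C> = sets borel"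
    and pos: "AE x in \<C>. 0 < x" and int: "integrable \<C> (\<lambda>x. x)" and mean: "(\<integral>x. x \<partial>\<C>) = c"
    using cost by (auto simp: cost_distribution_def mean_def)
  define h where "h n x = (1 - exp (- (1 / real (Suc n)) * x)) * real (Suc n)" for n and x :: real
  have "(\<lambda>n. \<integral>x. h n x \<partial>\<C>) \<longlonglongrightarrow> (\<integral>x. x \<partial>\<C>)"
  proof (rule integral_dominated_convergence[where w="\<lambda>x. x"])
    show "AE x in \<C>. (\<lambda>n. h n x) \<longlonglongrightarrow> x"
    proof (rule AE_I2)
      fix x
      have "((\<lambda>y. exp (- y * x)) has_real_derivative - x) (at 0)"
        by (auto intro!: derivative_eq_intros)
      then have "((\<lambda>y. (exp (- y * x) - 1) / y) \<longlongrightarrow> - x) (at 0)"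
        by (simp add: DERIV_def)
      moreover have "filterlim (\<lambda>n. 1 / real (Suc n)) (at 0) sequentially"
        using LIMSEQ_Suc[OF lim_inverse_n'] by (simp add: filterlim_at)
      ultimately have "(\<lambda>n. (exp (- (1 / real (Suc n)) * x) - 1) / (1 / real (Suc n))) \<longlonglongrightarrow> - x"
        by (rule filterlim_compose)
      then have "(\<lambda>n. - ((exp (- (1 / real (Suc n)) * x) - 1) / (1 / real (Suc n)))) \<longlonglongrightarrow> - (- x)"
        by (rule tendsto_minus)
      then show "(\<lambda>n. h n x) \<longlonglongrightarrow> x"
        by (simp add: h_def algebra_simps)
    qed
    show "AE x in \<C>. norm (h n x) \<le> x" for n
      using pos
    proof eventually_elim
      fix x :: real assume "0 < x"
      moreover have "1 - exp (- (1 / real (Suc n)) * x) \<le> (1 / real (Suc n)) * x"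
        using exp_ge_add_one_self[of "- (1 / real (Suc n)) * x"] by simp
      then have "h n x \<le> (1 / real (Suc n)) * x * real (Suc n)"
        unfolding h_def by (rule mult_right_mono) simp
      moreover have "0 \<le> h n x"
        using \<open>0 < x\<close> by (auto simp: h_def)
      ultimately show "norm (h n x) \<le> x" by simp
    qed
  qed (auto simp: int h_def)
  then have "\<forall>\<^sub>F n in sequentially. c' < (\<integral>x. h n x \<partial>\<C>)"
    using \<open>c' < c\<close> by (intro order_tendstoD) (auto simp: mean)
  then obtain n where n: "c' < (\<integral>x. h n x \<partial>\<C>)"
    by (auto dest: eventually_happens)
  define s where "s = 1 / real (Suc n)"
  have s: "0 < s" by (simp add: s_def)
  have "integrable \<C> (\<lambda>x. exp (- s * x))"
    using pos s by (intro C.integrable_const_bound[where B=1]) (auto elim!: eventually_mono)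
  then have "(\<integral>x. h n x \<partial>\<C>) = (1 - (\<integral>x. exp (- s * x) \<partial>\<C>)) * real (Suc n)"
    unfolding h_def s_def by (simp add: C.prob_space)
  then have "(\<integral>x. exp (- s * x) \<partial>\<C>) < 1 - s * c'"
    using n by (simp add: s_def field_simps)
  also have "\<dots> \<le> exp (- s * c')"
    using exp_ge_add_one_self[of "- s * c'"] by simp
  finally show thesis using s that by blast
qed

text \<open>
  With positive costs, affording more than \<open>n\<close> samples forces the first \<open>n\<close> costs to sum to at most
  \<open>B\<close>; the Chernoff bound for this lower deviation involves only the Laplace transform of the costs.
\<close>

lemma prob_num_samples_gt_le:
  assumes cost: "cost_distribution \<C> c" and "0 < s" and B: "B \<le> c' * real n"
  shows "measure (PiM UNIV (\<lambda>_. \<C>)) {x \<in> space (PiM UNIV (\<lambda>_. \<C>)). n < num_samples B x}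
    \<le> (exp (s * c') * (\<integral>x. exp (- s * x) \<partial>\<C>)) ^ n"
proof -
  interpret C: prob_space \<C> using cost by (simp add: cost_distribution_def)
  interpret CP: product_prob_space "\<lambda>_. \<C>" "UNIV :: nat set"
    by (rule product_prob_spaceI) (rule C.prob_space_axioms)
  have sets_C [measurable_cong, simp]: "sets \<C> = sets borel" and pos: "AE x in \<C>. 0 < x"
    using cost by (auto simp: cost_distribution_def)
  let ?M = "PiM (UNIV :: nat set) (\<lambda>_. \<C>)" and ?\<phi> = "\<integral>x. exp (- s * x) \<partial>\<C>"
  have int: "integrable \<C> (\<lambda>x. exp (- s * x))"
  proof (rule C.integrable_const_bound[where B=1])
    show "AE x in \<C>. norm (exp (- s * x)) \<le> 1"
      using pos by eventually_elim (use \<open>0 < s\<close> in simp)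
  qed measurable
  have factor_measurable: "(\<lambda>y. ennreal (exp (- s * y))) \<in> borel_measurable \<C>" by measurable
  have exp_measurable: "(\<lambda>x. \<Prod>i<n. ennreal (exp (- s * x i))) \<in> borel_measurable (PiM {..<n} (\<lambda>_. \<C>))"
  proof (rule borel_measurable_prod_ennreal)
    fix i assume "i \<in> {..<n}"
    then have "(\<lambda>x. x i) \<in> measurable (PiM {..<n} (\<lambda>_. \<C>)) \<C>"
      by (rule measurable_component_singleton)
    then show "(\<lambda>x. ennreal (exp (- s * x i))) \<in> borel_measurable (PiM {..<n} (\<lambda>_. \<C>))"
      by (rule measurable_compose) (rule factor_measurable)
  qed
  have [measurable]: "(\<lambda>c. c i) \<in> borel_measurable ?M" for i
    using measurable_component_singleton[of i UNIV "\<lambda>_. \<C>"]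
    by (simp add: measurable_cong_sets[OF refl sets_C])
  have [measurable]: "num_samples B \<in> measurable ?M (count_space UNIV)"
    by (rule measurable_num_samples) simp
  have "AE x in ?M. \<forall>i. 0 < x i"
    unfolding AE_all_countable
    by (intro allI AE_PiM_component) (auto simp: C.prob_space_axioms pos)
  then have "emeasure ?M {x \<in> space ?M. n < num_samples B x} \<le>
      (\<integral>\<^sup>+x. ennreal (exp (s * B)) * (\<Prod>i<n. ennreal (exp (- s * x i))) \<partial>?M)"
  proof (subst nn_integral_indicator[symmetric], goal_cases)
    case 2
    show ?case
    proof (rule nn_integral_mono_AE, use 2 in eventually_elim)
      fix x :: "nat \<Rightarrow> real" assume x: "\<forall>i. 0 < x i"
      show "indicator {x \<in> space ?M. n < num_samples B x} x
        \<le> ennreal (exp (s * B)) * (\<Prod>i<n. ennreal (exp (- s * x i)))"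
      proof (cases "n < num_samples B x")
        case True
        \<comment> \<open>If the first \<open>n\<close> costs summed to more than \<open>B\<close>, no number above \<open>n\<close> would be affordable.\<close>
        have sum_le: "(\<Sum>i<n. x i) \<le> B"
        proof (rule ccontr)
          assume *: "\<not> ?thesis"
          have "m \<le> n" if "(\<Sum>i<m. x i) \<le> B" for m
          proof (rule ccontr)
            assume "\<not> m \<le> n"
            then have "(\<Sum>i<n. x i) \<le> (\<Sum>i<m. x i)"
              using x by (intro sum_mono2) (auto simp: less_imp_le)
            with that * show False by simp
          qed
          then have "num_samples B x \<le> n"
            unfolding num_samples_def
            by (cases "{n. 0 < n \<and> (\<Sum>i<n. x i) \<le> B} = {}") (simp only: Sup_nat_empty, auto intro!: cSup_least)
          with True show False by simp
        qed
        then have "1 \<le> exp (s * B) * exp (- s * (\<Sum>i<n. x i))"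
          using \<open>0 < s\<close> by (simp add: exp_add[symmetric])
        also have "exp (- s * (\<Sum>i<n. x i)) = (\<Prod>i<n. exp (- s * x i))"
          by (simp add: exp_sum[symmetric] sum_distrib_left sum_negf)
        finally have "1 \<le> ennreal (exp (s * B) * (\<Prod>i<n. exp (- s * x i)))"
          by simp
        also have "\<dots> = ennreal (exp (s * B)) * (\<Prod>i<n. ennreal (exp (- s * x i)))"
          by (simp add: prod_ennreal prod_nonneg ennreal_mult)
        finally show ?thesis by (auto simp: indicator_def)
      qed simp
    qed
  qed measurable
  also have "\<dots> = ennreal (exp (s * B)) * (\<integral>\<^sup>+x. (\<Prod>i<n. ennreal (exp (- s * x i))) \<partial>?M)"
    by (rule nn_integral_cmult) measurable
  also have "(\<integral>\<^sup>+x. (\<Prod>i<n. ennreal (exp (- s * x i))) \<partial>?M)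
    = (\<integral>\<^sup>+x. (\<Prod>i<n. ennreal (exp (- s * x i))) \<partial>distr ?M (PiM {..<n} (\<lambda>_. \<C>)) (\<lambda>x. restrict x {..<n}))"
    using exp_measurable
    by (subst nn_integral_distr) (auto intro!: measurable_restrict_subset nn_integral_cong)
  also have "\<dots> = (\<integral>\<^sup>+x. (\<Prod>i<n. ennreal (exp (- s * x i))) \<partial>PiM {..<n} (\<lambda>_. \<C>))"
    by (subst CP.distr_PiM_restrict_finite) auto
  also have "\<dots> = (\<Prod>i<n. \<integral>\<^sup>+x. ennreal (exp (- s * x)) \<partial>\<C>)"
    by (rule CP.product_nn_integral_prod[OF finite_lessThan factor_measurable])
  also have "\<dots> = ennreal (?\<phi> ^ n)"
    using int by (simp add: nn_integral_eq_integral ennreal_power integral_nonneg_AE)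
  finally have "measure ?M {x \<in> space ?M. n < num_samples B x} \<le> exp (s * B) * ?\<phi> ^ n"
    by (simp add: CP.P.emeasure_eq_measure ennreal_mult[symmetric] integral_nonneg_AE ennreal_le_iff)
  also have "\<dots> \<le> exp (s * c' * real n) * ?\<phi> ^ n"
    using B \<open>0 < s\<close> by (intro mult_right_mono) (auto simp: integral_nonneg_AE mult.assoc)
  also have "\<dots> = (exp (s * c') * ?\<phi>) ^ n"
    by (simp add: power_mult_distrib exp_of_nat2_mult)
  finally show ?thesis .
qed

lemma prob_space_joint_law:
  assumes "prob_space \<nu>" "prob_space \<C>"
  shows "prob_space (joint_law \<nu> \<C>)"
proof -
  interpret N: prob_space "PiM (UNIV :: nat set) (\<lambda>_. \<nu>)" by (intro prob_space_PiM assms)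
  interpret C: prob_space "PiM (UNIV :: nat set) (\<lambda>_. \<C>)" by (intro prob_space_PiM assms)
  interpret pair_prob_space "PiM (UNIV :: nat set) (\<lambda>_. \<nu>)" "PiM (UNIV :: nat set) (\<lambda>_. \<C>)" ..
  show ?thesis unfolding joint_law_def by unfold_locales
qed

section \<open>Mean and divergence in a one-parameter exponential family\<close>

locale one_parameter_family =
  fixes \<xi> :: "real measure" and b :: "real \<Rightarrow> real"
  assumes family: "exponential_family \<xi> b"
begin

abbreviation "\<Theta> \<equiv> param_space \<xi>"
abbreviation "p \<equiv> exp_fam_member \<xi> b"

lemma sets_reference [measurable_cong, simp]: "sets \<xi> = sets borel"
  using family by (simp add: exponential_family_def)

lemma sets_member [measurable_cong, simp]: "sets (p \<theta>) = sets borel"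
  by (simp add: exp_fam_member_def)

lemma space_member [simp]: "space (p \<theta>) = UNIV"
  using sets_eq_imp_space_eq[OF sets_member] by simp

lemma open_\<Theta>: "open \<Theta>" and is_interval_\<Theta>: "is_interval \<Theta>"
  and prob_space_member: "\<theta> \<in> \<Theta> \<Longrightarrow> prob_space (p \<theta>)"
  using family by (auto simp: exponential_family_def)

lemma has_deriv: "\<theta> \<in> \<Theta> \<Longrightarrow> (b has_real_derivative deriv b \<theta>) (at \<theta>)"
  and isCont_deriv: "\<theta> \<in> \<Theta> \<Longrightarrow> isCont (deriv b) \<theta>"
  using family by (auto simp: exponential_family_def DERIV_deriv_iff_real_differentiable
      differentiable_imp_continuous_within)

definition likelihood_ratio :: "real \<Rightarrow> real \<Rightarrow> real \<Rightarrow> real" where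
  "likelihood_ratio \<theta> \<theta>' x = exp ((\<theta> - \<theta>') * x - (b \<theta> - b \<theta>'))"

lemma likelihood_ratio_pos: "0 < likelihood_ratio \<theta> \<theta>' x"
  by (simp add: likelihood_ratio_def)

lemma measurable_likelihood_ratio [measurable]: "likelihood_ratio \<theta> \<theta>' \<in> borel_measurable borel"
  unfolding likelihood_ratio_def by measurable

lemma member_eq_density: "p \<theta> = density (p \<theta>') (likelihood_ratio \<theta> \<theta>')"
  unfolding exp_fam_member_def
  by (subst density_density_eq)
     (auto simp: likelihood_ratio_def ennreal_mult[symmetric] exp_add[symmetric] algebra_simps)

lemma integrable_member: "\<theta> \<in> \<Theta> \<Longrightarrow> integrable (p \<theta>) (\<lambda>x. x)"
proof -
  assume "\<theta> \<in> \<Theta>"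
  have "integrable \<xi> (\<lambda>x. x * exp (\<theta> * x))"
    using \<open>\<theta> \<in> \<Theta>\<close> by (intro integrableI_bounded) (auto simp: param_space_def abs_mult)
  then have "integrable \<xi> (\<lambda>x. exp (- b \<theta>) * (x * exp (\<theta> * x)))"
    by simp
  also have "(\<lambda>x. exp (- b \<theta>) * (x * exp (\<theta> * x))) = (\<lambda>x. exp (\<theta> * x - b \<theta>) *\<^sub>R x)"
    by (auto simp: exp_diff exp_minus divide_simps)
  finally show ?thesis
    unfolding exp_fam_member_def by (subst integrable_density) auto
qed

text \<open>
  Integrate \<open>1 + u \<le> exp u\<close> against \<open>p \<theta>\<close>, where \<open>exp u\<close> is the likelihood ratio of \<open>p \<theta>'\<close> to \<open>p \<theta>\<close>,
  whose integral is 1.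
\<close>

lemma subgradient_mean:
  assumes "\<theta> \<in> \<Theta>" "\<theta>' \<in> \<Theta>"
  shows "b \<theta> + mean (p \<theta>) * (\<theta>' - \<theta>) \<le> b \<theta>'"
proof -
  interpret P: prob_space "p \<theta>" by (intro prob_space_member assms)
  interpret P': prob_space "p \<theta>'" by (intro prob_space_member assms)
  note [simp] = integrable_member[OF assms(1)]
  have "emeasure (density (p \<theta>) (likelihood_ratio \<theta>' \<theta>)) (space (p \<theta>)) = 1"
    using P'.emeasure_space_1 unfolding member_eq_density[of \<theta>' \<theta>] by simp
  then have 1: "(\<integral>\<^sup>+x. likelihood_ratio \<theta>' \<theta> x \<partial>p \<theta>) = 1"
    by (subst (asm) emeasure_density) (auto cong: nn_integral_cong)
  have int: "integrable (p \<theta>) (likelihood_ratio \<theta>' \<theta>)"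
    using 1 likelihood_ratio_pos by (intro integrableI_nonneg) (auto simp: less_imp_le)
  have "1 + ((\<theta>' - \<theta>) * mean (p \<theta>) - (b \<theta>' - b \<theta>))
      = (\<integral>x. 1 + ((\<theta>' - \<theta>) * x - (b \<theta>' - b \<theta>)) \<partial>p \<theta>)"
    by (simp add: mean_def P.prob_space[simplified] algebra_simps)
  also have "\<dots> \<le> (\<integral>x. likelihood_ratio \<theta>' \<theta> x \<partial>p \<theta>)"
    by (intro integral_mono int) (auto simp: likelihood_ratio_def intro: exp_ge_add_one_self)
  also have "\<dots> = 1"
    using 1 likelihood_ratio_pos by (subst integral_eq_nn_integral) (auto simp: less_imp_le)
  finally show ?thesis by (simp add: algebra_simps)
qed

text \<open>
  By the subgradient inequality, subtracting from \<open>b\<close> the line through \<open>\<theta>\<close> with slope the mean gives a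
  function with a minimum at \<open>\<theta>\<close>.
\<close>

lemma mean_member: 
  assumes "\<theta> \<in> \<Theta>"
  shows "mean (p \<theta>) = deriv b \<theta>"
proof -
  obtain e where e: "0 < e" "ball \<theta> e \<subseteq> \<Theta>"
    using open_\<Theta> assms open_contains_ball by blast
  have "((\<lambda>t. b t - mean (p \<theta>) * (t - \<theta>)) has_real_derivative deriv b \<theta> - mean (p \<theta>)) (at \<theta>)"
    by (auto intro!: derivative_eq_intros has_deriv assms)
  then have "deriv b \<theta> - mean (p \<theta>) = 0"
  proof (rule DERIV_local_min[OF _ e(1)], intro allI impI)
    fix t assume "\<bar>\<theta> - t\<bar> < e"
    then have "t \<in> \<Theta>" using e by (auto simp: dist_real_def)
    then show "b \<theta> - mean (p \<theta>) * (\<theta> - \<theta>) \<le> b t - mean (p \<theta>) * (t - \<theta>)"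
      using subgradient_mean[OF assms] by (simp add: algebra_simps)
  qed
  then show ?thesis by simp
qed

text \<open>
  At the midpoint of \<open>\<theta>\<close> and \<open>\<theta>'\<close> the plain subgradient inequality holds, and strict convexity puts
  the average of the end values strictly above \<open>b\<close> there.
\<close>

lemma strict_subgradient:
  assumes "\<theta> \<in> \<Theta>" "\<theta>' \<in> \<Theta>" "\<theta> \<noteq> \<theta>'"
  shows "b \<theta> + deriv b \<theta> * (\<theta>' - \<theta>) < b \<theta>'"
proof -
  let ?m = "(1 - 1/2) * \<theta> + 1/2 * \<theta>'"
  have "\<forall>t\<in>{0<..<1}. b ((1 - t) * \<theta> + t * \<theta>') < (1 - t) * b \<theta> + t * b \<theta>'"
    using family assms unfolding exponential_family_def strictly_convex_on_def by blast
  from bspec[OF this, of "1/2"] have "b ?m < (b \<theta> + b \<theta>') / 2"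
    by simp
  moreover have "?m \<in> \<Theta>"
  proof -
    have "convex \<Theta>" using is_interval_\<Theta> is_interval_convex by blast
    from convexD_alt[OF this assms(1,2), of "1/2"] show ?thesis by simp
  qed
  then have "b \<theta> + deriv b \<theta> * (?m - \<theta>) \<le> b ?m"
    using subgradient_mean[of \<theta> ?m] assms mean_member by simp
  ultimately show ?thesis by (simp add: field_simps)
qed

lemma deriv_strict_mono:
  assumes "\<theta> \<in> \<Theta>" "\<theta>' \<in> \<Theta>" "\<theta> < \<theta>'"
  shows "deriv b \<theta> < deriv b \<theta>'"
proof -
  have "deriv b \<theta> * (\<theta>' - \<theta>) < b \<theta>' - b \<theta>" "deriv b \<theta>' * (\<theta> - \<theta>') < b \<theta> - b \<theta>'"
    using strict_subgradient[of \<theta> \<theta>'] strict_subgradient[of \<theta>' \<theta>] assms by auto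
  then have "deriv b \<theta> * (\<theta>' - \<theta>) < deriv b \<theta>' * (\<theta>' - \<theta>)"
    by (simp add: algebra_simps)
  then show ?thesis using assms by (simp add: mult_less_cancel_right)
qed

lemma param_of_mean_deriv: "\<theta> \<in> \<Theta> \<Longrightarrow> param_of_mean \<xi> b (deriv b \<theta>) = \<theta>"
  unfolding param_of_mean_def
  by (intro the_inv_into_f_f inj_onI) (metis deriv_strict_mono less_irrefl linorder_neqE)

lemma mean_range_eq: "mean_range \<xi> b = deriv b ` \<Theta>"
  by (auto simp: mean_range_def exp_fam_def mean_member image_iff)

lemma mean_divergence_eq:
  assumes "\<theta> \<in> \<Theta>" "\<theta>' \<in> \<Theta>"
  shows "mean_divergence \<xi> b (deriv b \<theta>) (deriv b \<theta>') = b \<theta>' - b \<theta> - deriv b \<theta> * (\<theta>' - \<theta>)"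
proof -
  interpret P: prob_space "p \<theta>" by (intro prob_space_member assms)
  interpret P': prob_space "p \<theta>'" by (intro prob_space_member assms)
  let ?L = "likelihood_ratio \<theta> \<theta>'"
  have [simp]: "0 \<le> ?L x" for x using likelihood_ratio_pos[of \<theta> \<theta>' x] by simp
  have log: "log (exp 1) y = ln y" for y by (simp add: log_def)
  have "mean_divergence \<xi> b (deriv b \<theta>) (deriv b \<theta>') = KL_divergence (exp 1) (p \<theta>') (density (p \<theta>') ?L)"
    using assms by (simp add: mean_divergence_def param_of_mean_deriv flip: member_eq_density)
  also have "\<dots> = (\<integral>x. ?L x * ln (?L x) \<partial>p \<theta>')"
    by (subst P'.KL_density) (auto simp: log)
  also have "\<dots> = (\<integral>x. ln (?L x) \<partial>density (p \<theta>') ?L)"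
    by (subst integral_real_density) auto
  also have "\<dots> = (\<integral>x. (\<theta> - \<theta>') * x - (b \<theta> - b \<theta>') \<partial>p \<theta>)"
    unfolding member_eq_density[of \<theta> \<theta>', symmetric] by (simp add: likelihood_ratio_def)
  also have "\<dots> = (\<theta> - \<theta>') * mean (p \<theta>) - (b \<theta> - b \<theta>')"
    using integrable_member[OF assms(1)] by (simp add: mean_def P.prob_space[simplified] algebra_simps)
  finally show ?thesis by (simp add: mean_member assms algebra_simps)
qed

text \<open>
  The three-point identity writes \<open>d(m, m2)\<close> as \<open>d(m, m1) + d(m1, m2) + (m1 - m) (t2 - t1)\<close>, where \<open>t1\<close>
  and \<open>t2\<close> are the parameters of \<open>m1\<close> and \<open>m2\<close>. The last two terms are positive when \<open>m1\<close> lies strictly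
  between \<open>m\<close> and \<open>m2\<close>.
\<close>

lemma mean_divergence_less:
  assumes "m \<in> mean_range \<xi> b" "m1 \<in> mean_range \<xi> b" "m2 \<in> mean_range \<xi> b"
    and between: "m < m1 \<and> m1 < m2 \<or> m2 < m1 \<and> m1 < m"
  shows "mean_divergence \<xi> b m m1 < mean_divergence \<xi> b m m2"
proof -
  obtain t t1 t2 where t: "t \<in> \<Theta>" "t1 \<in> \<Theta>" "t2 \<in> \<Theta>" "m = deriv b t" "m1 = deriv b t1" "m2 = deriv b t2"
    using assms by (auto simp: mean_range_eq)
  have less: "x < y" if "deriv b x < deriv b y" "x \<in> \<Theta>" "y \<in> \<Theta>" for x y
    using deriv_strict_mono[of y x] that by (cases x y rule: linorder_cases) auto
  have "0 < (deriv b t1 - deriv b t) * (t2 - t1)"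
    using between t less[of t1 t2] less[of t2 t1] by (auto intro: mult_pos_pos mult_neg_neg)
  moreover have "b t1 + deriv b t1 * (t2 - t1) < b t2"
    using between t by (intro strict_subgradient) auto
  ultimately show ?thesis
    using t by (simp add: mean_divergence_eq algebra_simps)
qed

text \<open>
  In terms of the parameter, the divergence from \<open>m\<close> is continuous on the segment between the two
  parameters and vanishes at the parameter of \<open>m\<close>, so it takes the value \<open>v\<close> on that segment.
\<close>

lemma mean_divergence_attains:
  assumes "m \<in> mean_range \<xi> b" "m' \<in> mean_range \<xi> b" "0 < v" "v \<le> mean_divergence \<xi> b m m'"
  obtains l where "l \<in> mean_range \<xi> b" "mean_divergence \<xi> b m l = v" "m < m' \<Longrightarrow> m < l" "m' < m \<Longrightarrow> l < m"
proof -
  obtain t t' where t: "t \<in> \<Theta>" "t' \<in> \<Theta>" "m = deriv b t" "m' = deriv b t'"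
    using assms by (auto simp: mean_range_eq)
  define g where "g s = b s - b t - deriv b t * (s - t)" for s
  have seg: "closed_segment t t' \<subseteq> \<Theta>"
    using is_interval_\<Theta> t by (simp add: closed_segment_subset is_interval_convex_1)
  have "continuous_on \<Theta> b"
    using has_deriv by (intro continuous_at_imp_continuous_on) (auto intro: DERIV_isCont)
  then have "continuous_on (closed_segment t t') g"
    unfolding g_def by (intro continuous_intros continuous_on_subset[OF _ seg])
  then have "connected (g ` closed_segment t t')"
    by (intro connected_continuous_image) auto
  moreover have "g t = 0" "v \<le> g t'"
    using assms t by (auto simp: g_def mean_divergence_eq)
  ultimately have "v \<in> g ` closed_segment t t'"
    using connectedD_interval[of "g ` closed_segment t t'" "g t" "g t'" v] \<open>0 < v\<close> by simp
  then obtain s where s: "s \<in> closed_segment t t'" "g s = v" by auto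
  with seg have s_in: "s \<in> \<Theta>" by auto
  have "s \<noteq> t" using \<open>0 < v\<close> s \<open>g t = 0\<close> by auto
  have mono: "t < t'" if "m < m'" using that t deriv_strict_mono[of t' t] by (cases t t' rule: linorder_cases) auto
  have mono': "t' < t" if "m' < m" using that t deriv_strict_mono[of t t'] by (cases t t' rule: linorder_cases) auto
  show thesis
  proof
    show "deriv b s \<in> mean_range \<xi> b" using s_in by (simp add: mean_range_eq)
    show "mean_divergence \<xi> b m (deriv b s) = v" using s s_in t by (simp add: mean_divergence_eq g_def)
    show "m < deriv b s" if "m < m'"
      using mono[OF that] s s_in t \<open>s \<noteq> t\<close> by (auto simp: closed_segment_eq_real_ivl intro!: deriv_strict_mono)
    show "deriv b s < m" if "m' < m"
      using mono'[OF that] s s_in t \<open>s \<noteq> t\<close> by (auto simp: closed_segment_eq_real_ivl intro!: deriv_strict_mono)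
  qed
qed

section \<open>The limiting endpoints\<close>

lemma mean_range_between:
  assumes "x \<in> mean_range \<xi> b" "y \<in> mean_range \<xi> b" "x \<le> z" "z \<le> y"
  shows "z \<in> mean_range \<xi> b"
proof -
  have "connected \<Theta>" using is_interval_\<Theta> by (simp add: is_interval_connected)
  then have "connected (mean_range \<xi> b)"
    unfolding mean_range_eq
    by (intro connected_continuous_image continuous_at_imp_continuous_on ballI isCont_deriv)
  then show ?thesis
    using assms by (rule connectedD_interval)
qed

lemma solves_left_unique:
  assumes "\<mu> \<in> mean_range \<xi> b" "solves_left \<xi> b \<mu> k c l" "solves_left \<xi> b \<mu> k c l'"
  shows "l' = l"
  using assms(2,3) mean_divergence_less[OF assms(1), of l l'] mean_divergence_less[OF assms(1), of l' l]
  by (cases l l' rule: linorder_cases) (auto simp: solves_left_def)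

lemma solves_right_unique:
  assumes "\<mu> \<in> mean_range \<xi> b" "solves_right \<xi> b \<mu> k c r" "solves_right \<xi> b \<mu> k c r'"
  shows "r' = r"
  using assms(2,3) mean_divergence_less[OF assms(1), of r r'] mean_divergence_less[OF assms(1), of r' r]
  by (cases r r' rule: linorder_cases) (auto simp: solves_right_def)

lemma ex1_solves_left:
  assumes "\<mu> \<in> mean_range \<xi> b" "m \<in> mean_range \<xi> b" "m < \<mu>" "0 < c / k" "c / k \<le> mean_divergence \<xi> b \<mu> m"
  shows "\<exists>!l. solves_left \<xi> b \<mu> k c l"
proof -
  obtain l where "solves_left \<xi> b \<mu> k c l"
    using mean_divergence_attains[OF assms(1,2,4,5)] assms(3) by (auto simp: solves_left_def)
  then show ?thesis
    using solves_left_unique[OF assms(1)] by (intro ex1I[of _ l])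
qed

lemma ex1_solves_right:
  assumes "\<mu> \<in> mean_range \<xi> b" "m \<in> mean_range \<xi> b" "\<mu> < m" "0 < c / k" "c / k \<le> mean_divergence \<xi> b \<mu> m"
  shows "\<exists>!r. solves_right \<xi> b \<mu> k c r"
proof -
  obtain r where "solves_right \<xi> b \<mu> k c r"
    using mean_divergence_attains[OF assms(1,2,4,5)] assms(3) by (auto simp: solves_right_def)
  then show ?thesis
    using solves_right_unique[OF assms(1)] by (intro ex1I[of _ r])
qed

text \<open>
  The means at divergence below \<open>c / k\<close> come arbitrarily close to \<open>left_star\<close> from above, whether
  it is a solution of the equation or the lower end of the mean range: in the second case no mean
  below \<open>\<mu>\<close> reaches the divergence \<open>c / k\<close>. A lower bound of these means is thus a lower bound
  of \<open>left_star\<close>.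
\<close>

lemma left_star_greatest:
  assumes \<mu>: "\<mu> \<in> mean_range \<xi> b" and ck: "0 < c / k" and L: "L \<le> ereal \<mu>"
    and near: "\<And>m. m \<in> mean_range \<xi> b \<Longrightarrow> mean_divergence \<xi> b \<mu> m < c / k \<Longrightarrow> L \<le> ereal m"
  shows "L \<le> left_star \<xi> b \<mu> k c"
proof (cases "\<exists>l. solves_left \<xi> b \<mu> k c l")
  case True
  then obtain l where sol: "solves_left \<xi> b \<mu> k c l" by blast
  then have l: "l \<in> mean_range \<xi> b" "l < \<mu>" "mean_divergence \<xi> b \<mu> l = c / k"
    by (auto simp: solves_left_def)
  have "(THE l. solves_left \<xi> b \<mu> k c l) = l"
    using sol solves_left_unique[OF \<mu> sol] by (rule the_equality)
  with True have "left_star \<xi> b \<mu> k c = ereal l"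
    by (simp add: left_star_def)
  moreover have "L \<le> ereal l"
  proof (rule ccontr)
    assume "\<not> L \<le> ereal l"
    then have "ereal l < L" by simp
    then obtain m where m: "l < m" "ereal m < L" "m < \<mu>"
      using ereal_dense2[of "ereal l" "min L (ereal \<mu>)"] l by auto
    then have m_range: "m \<in> mean_range \<xi> b"
      using mean_range_between[OF l(1) \<mu>] by simp
    then have "mean_divergence \<xi> b \<mu> m < c / k"
      using mean_divergence_less[OF \<mu> _ l(1), of m] m l by simp
    with near[OF m_range] m show False by auto
  qed
  ultimately show ?thesis by simp
next
  case False
  have "L \<le> ereal m" if m: "m \<in> mean_range \<xi> b" for m
  proof (cases "m < \<mu>")
    case True
    then have "mean_divergence \<xi> b \<mu> m < c / k"
      using False ex1_solves_left[OF \<mu> m _ ck] by (metis not_le)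
    with near[OF m] show ?thesis .
  next
    case False
    then show ?thesis using L order_trans[of L "ereal \<mu>" "ereal m"] by simp
  qed
  then have "L \<le> (INF m\<in>mean_range \<xi> b. ereal m)" by (rule INF_greatest)
  then show ?thesis unfolding left_star_def if_not_P[OF False] .
qed

lemma right_star_least:
  assumes \<mu>: "\<mu> \<in> mean_range \<xi> b" and ck: "0 < c / k" and R: "ereal \<mu> \<le> R"
    and near: "\<And>m. m \<in> mean_range \<xi> b \<Longrightarrow> mean_divergence \<xi> b \<mu> m < c / k \<Longrightarrow> ereal m \<le> R"
  shows "right_star \<xi> b \<mu> k c \<le> R"
proof (cases "\<exists>r. solves_right \<xi> b \<mu> k c r")
  case True
  then obtain r where sol: "solves_right \<xi> b \<mu> k c r" by blast
  then have r: "r \<in> mean_range \<xi> b" "\<mu> < r" "mean_divergence \<xi> b \<mu> r = c / k"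
    by (auto simp: solves_right_def)
  have "(THE r. solves_right \<xi> b \<mu> k c r) = r"
    using sol solves_right_unique[OF \<mu> sol] by (rule the_equality)
  with True have "right_star \<xi> b \<mu> k c = ereal r"
    by (simp add: right_star_def)
  moreover have "ereal r \<le> R"
  proof (rule ccontr)
    assume "\<not> ereal r \<le> R"
    then have "R < ereal r" by simp
    then obtain m where m: "m < r" "R < ereal m" "\<mu> < m"
      using ereal_dense2[of "max R (ereal \<mu>)" "ereal r"] r by auto
    then have m_range: "m \<in> mean_range \<xi> b"
      using mean_range_between[OF \<mu> r(1)] by simp
    then have "mean_divergence \<xi> b \<mu> m < c / k"
      using mean_divergence_less[OF \<mu> _ r(1), of m] m r by simp
    with near[OF m_range] m show False by auto
  qed
  ultimately show ?thesis by simp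
next
  case False
  have "ereal m \<le> R" if m: "m \<in> mean_range \<xi> b" for m
  proof (cases "\<mu> < m")
    case True
    then have "mean_divergence \<xi> b \<mu> m < c / k"
      using False ex1_solves_right[OF \<mu> m _ ck] by (metis not_le)
    with near[OF m] show ?thesis .
  next
    case False
    then show ?thesis using R order_trans[of "ereal m" "ereal \<mu>" R] by simp
  qed
  then have "(SUP m\<in>mean_range \<xi> b. ereal m) \<le> R" by (rule SUP_least)
  then show ?thesis unfolding right_star_def if_not_P[OF False] .
qed

section \<open>Moments of the likelihood ratio\<close>

text \<open>
  Raising the likelihood ratio to the power \<open>1 + \<eta>\<close> moves the parameter from \<open>\<theta>\<close> to
  \<open>\<theta> + \<eta> (\<theta> - \<theta>')\<close>, away from \<open>\<theta>'\<close>, up to a constant factor.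
\<close>

lemma likelihood_ratio_moment:
  assumes "\<theta> + \<eta> * (\<theta> - \<theta>') \<in> \<Theta>"
  shows "(\<integral>\<^sup>+x. ennreal (likelihood_ratio \<theta> \<theta>' x powr (1 + \<eta>)) \<partial>p \<theta>')
    = ennreal (exp (b (\<theta> + \<eta> * (\<theta> - \<theta>')) - b \<theta> - \<eta> * (b \<theta> - b \<theta>')))"
    (is "_ = ennreal (exp ?\<psi>)")
proof -
  interpret prob_space "p (\<theta> + \<eta> * (\<theta> - \<theta>'))" by (intro prob_space_member assms)
  have "(\<integral>\<^sup>+x. ennreal (likelihood_ratio \<theta> \<theta>' x powr (1 + \<eta>)) \<partial>p \<theta>')
    = (\<integral>\<^sup>+x. ennreal (exp (\<theta>' * x - b \<theta>')) * ennreal (likelihood_ratio \<theta> \<theta>' x powr (1 + \<eta>)) \<partial>\<xi>)"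
    unfolding exp_fam_member_def[of _ _ \<theta>'] by (rule nn_integral_density) auto
  also have "\<dots> = (\<integral>\<^sup>+x. ennreal (exp ((\<theta> + \<eta> * (\<theta> - \<theta>')) * x - b (\<theta> + \<eta> * (\<theta> - \<theta>')))) * ennreal (exp ?\<psi>) \<partial>\<xi>)"
    by (intro nn_integral_cong)
       (auto simp: likelihood_ratio_def powr_def ennreal_mult[symmetric] exp_add[symmetric] algebra_simps)
  also have "\<dots> = (\<integral>\<^sup>+x. ennreal (exp ?\<psi>) \<partial>p (\<theta> + \<eta> * (\<theta> - \<theta>')))"
    unfolding exp_fam_member_def by (rule nn_integral_density[symmetric]) auto
  also have "\<dots> = ennreal (exp ?\<psi>)"
    by (simp add: emeasure_space_1[simplified])
  finally show ?thesis .
qed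

text \<open>
  The logarithm \<open>\<psi>\<close> of the moment of order \<open>1 + \<eta>\<close> vanishes at \<open>\<eta> = 0\<close> and has there the derivative
  \<open>d(\<mu>, m)\<close>, where \<open>\<mu>\<close> and \<open>m\<close> are the means at \<open>\<theta>\<close> and \<open>\<theta>'\<close>.
\<close>

lemma exists_tilt:
  assumes "\<theta> \<in> \<Theta>" "\<theta>' \<in> \<Theta>" and \<rho>: "mean_divergence \<xi> b (deriv b \<theta>) (deriv b \<theta>') < \<rho>"
  obtains \<eta> \<psi> where "0 < \<eta>" "0 \<le> \<psi>" "\<psi> < \<eta> * \<rho>"
    "(\<integral>\<^sup>+x. ennreal (likelihood_ratio \<theta> \<theta>' x powr (1 + \<eta>)) \<partial>p \<theta>') \<le> ennreal (exp \<psi>)"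
proof -
  define K where "K = b \<theta>' - b \<theta> - deriv b \<theta> * (\<theta>' - \<theta>)"
  have K: "0 \<le> K" "K < \<rho>"
    using subgradient_mean[OF assms(1,2)] \<rho> assms by (auto simp: K_def mean_divergence_eq mean_member)
  define \<psi> where "\<psi> \<eta> = b (\<theta> + \<eta> * (\<theta> - \<theta>')) - b \<theta> - \<eta> * (b \<theta> - b \<theta>')" for \<eta>
  have "((\<lambda>\<eta>. b (\<theta> + \<eta> * (\<theta> - \<theta>'))) has_real_derivative deriv b \<theta> * (\<theta> - \<theta>')) (at 0)"
    by (rule DERIV_chain2[where g="\<lambda>\<eta>. \<theta> + \<eta> * (\<theta> - \<theta>')"])
       (auto intro!: derivative_eq_intros has_deriv assms)
  then have "(\<psi> has_real_derivative K) (at 0)"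
    unfolding \<psi>_def[abs_def] K_def by (auto intro!: derivative_eq_intros simp: algebra_simps)
  then have "((\<lambda>\<eta>. \<psi> \<eta> / \<eta>) \<longlongrightarrow> K) (at 0)"
    by (simp add: DERIV_def \<psi>_def)
  then have "\<forall>\<^sub>F \<eta> in at_right 0. \<psi> \<eta> / \<eta> < \<rho>"
    using K by (intro order_tendstoD) (auto intro: filterlim_mono at_le)
  moreover have "((\<lambda>\<eta>. \<theta> + \<eta> * (\<theta> - \<theta>')) \<longlongrightarrow> \<theta> + 0 * (\<theta> - \<theta>')) (at_right 0)"
    by (intro tendsto_intros)
  then have "\<forall>\<^sub>F \<eta> in at_right 0. \<theta> + \<eta> * (\<theta> - \<theta>') \<in> \<Theta>"
    using assms open_\<Theta> by (intro topological_tendstoD) auto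
  moreover have "\<forall>\<^sub>F \<eta> in at_right 0. 0 < (\<eta> :: real)"
    by (rule eventually_at_right_less)
  ultimately have "\<forall>\<^sub>F \<eta> in at_right 0. \<psi> \<eta> / \<eta> < \<rho> \<and> \<theta> + \<eta> * (\<theta> - \<theta>') \<in> \<Theta> \<and> 0 < \<eta>"
    by eventually_elim auto
  then obtain \<eta> where \<eta>: "\<psi> \<eta> / \<eta> < \<rho>" "\<theta> + \<eta> * (\<theta> - \<theta>') \<in> \<Theta>" "0 < \<eta>"
    by (auto dest: eventually_happens)
  have "0 \<le> \<eta> * K" using K \<eta> by simp
  also have "\<dots> \<le> \<psi> \<eta>"
    using subgradient_mean[OF assms(1) \<eta>(2)] assms by (simp add: K_def \<psi>_def mean_member algebra_simps)
  finally have "0 \<le> \<psi> \<eta>" .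
  then show thesis
    using \<eta> likelihood_ratio_moment[OF \<eta>(2)]
    by (intro that[of \<eta> "\<psi> \<eta>"]) (auto simp: \<psi>_def divide_simps mult.commute)
qed

section \<open>Vanishing of events that are rare under another member\<close>

text \<open>
  Pick \<open>\<rho>\<close> slightly above the divergence and \<open>c'\<close> slightly below \<open>c\<close> so that still \<open>\<kappa> \<rho> < c'\<close>, and apply
  \<open>random_prefix_density_le\<close> with \<open>n = \<lceil>B \<delta> / c'\<rceil>\<close> samples and threshold \<open>t = n \<rho>\<close>. The term
  \<open>exp (n \<rho>) \<delta>\<close> vanishes because \<open>n \<rho> / ln (1 / \<delta>)\<close> tends to \<open>\<kappa> \<rho> / c' < 1\<close>; the other two are powers
  \<open>q ^ n\<close> with \<open>0 \<le> q < 1\<close>.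
\<close>

lemma prefix_event_vanishes:
  assumes \<theta>: "\<theta> \<in> \<Theta>" "\<theta>' \<in> \<Theta>"
    and cost: "cost_distribution \<C> c"
    and budget: "filterlim B at_top (at_right 0)"
    and rate: "((\<lambda>\<delta>. B \<delta> / ln (1 / \<delta>)) \<longlongrightarrow> \<kappa>) (at_right 0)" "0 \<le> \<kappa>"
    and slow: "\<kappa> * mean_divergence \<xi> b (deriv b \<theta>) (deriv b \<theta>') < c"
    and A: "\<And>\<delta> n. \<delta> \<in> {0<..<1} \<Longrightarrow> A \<delta> n \<in> sets (PiM {..<n} (\<lambda>_. borel))"
  defines "E \<equiv> \<lambda>t \<delta>. {\<omega> \<in> space (joint_law (p t) \<C>).
      restrict (fst \<omega>) {..<num_samples (B \<delta>) (snd \<omega>)} \<in> A \<delta> (num_samples (B \<delta>) (snd \<omega>))}"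
  assumes small: "\<And>\<delta>. \<delta> \<in> {0<..<1} \<Longrightarrow> measure (joint_law (p \<theta>') \<C>) (E \<theta>' \<delta>) \<le> \<delta>"
  shows "((\<lambda>\<delta>. measure (joint_law (p \<theta>) \<C>) (E \<theta> \<delta>)) \<longlongrightarrow> 0) (at_right 0)"
proof -
  let ?D = "mean_divergence \<xi> b (deriv b \<theta>) (deriv b \<theta>')"
  have "0 \<le> ?D"
    using subgradient_mean[OF \<theta>] \<theta> by (simp add: mean_divergence_eq mean_member)
  \<comment> \<open>The slack \<open>c - \<kappa> D\<close> is divided so that \<open>\<rho>\<close> exceeds \<open>D\<close> also when \<open>\<kappa> = 0\<close>.\<close>
  define \<rho> where "\<rho> = ?D + (c - \<kappa> * ?D) / (2 * (\<kappa> + 1))"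
  have \<rho>: "?D < \<rho>" "0 < \<rho>"
    using slow rate \<open>0 \<le> ?D\<close> by (auto simp: \<rho>_def intro!: add_nonneg_pos divide_pos_pos)
  have "\<kappa> / (2 * (\<kappa> + 1)) < 1"
    using rate by (simp add: field_simps)
  then have "\<kappa> / (2 * (\<kappa> + 1)) * (c - \<kappa> * ?D) < 1 * (c - \<kappa> * ?D)"
    using slow by (intro mult_strict_right_mono) auto
  moreover have "\<kappa> * \<rho> = \<kappa> * ?D + \<kappa> / (2 * (\<kappa> + 1)) * (c - \<kappa> * ?D)"
    by (simp add: \<rho>_def distrib_left)
  ultimately have "\<kappa> * \<rho> < \<kappa> * ?D + 1 * (c - \<kappa> * ?D)" by (metis add_strict_left_mono)
  then have "\<kappa> * \<rho> < c" by simp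
  then obtain c' where c': "\<kappa> * \<rho> < c'" "c' < c"
    using dense[of "\<kappa> * \<rho>" c] by auto
  have "0 < c'" using c'(1) rate \<rho> by (meson le_less_trans less_imp_le mult_nonneg_nonneg)
  obtain \<eta> \<psi> where \<eta>: "0 < \<eta>" "0 \<le> \<psi>" "\<psi> < \<eta> * \<rho>"
    "(\<integral>\<^sup>+x. ennreal (likelihood_ratio \<theta> \<theta>' x powr (1 + \<eta>)) \<partial>p \<theta>') \<le> ennreal (exp \<psi>)"
    using exists_tilt[OF \<theta> \<rho>(1)] by blast
  obtain s where s: "0 < s" "(\<integral>x. exp (- s * x) \<partial>\<C>) < exp (- s * c')"
    using cost_laplace_transform_lt[OF cost c'(2)] by blast
  define q where "q = exp (s * c') * (\<integral>x. exp (- s * x) \<partial>\<C>)"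
  have q: "0 \<le> q" "q < 1"
    using s by (auto simp: q_def integral_nonneg_AE exp_minus field_simps)
  define n where "n \<delta> = nat \<lceil>B \<delta> / c'\<rceil>" for \<delta>
  have n_ge: "B \<delta> \<le> c' * real (n \<delta>)" for \<delta>
  proof -
    have "B \<delta> / c' \<le> real (n \<delta>)" unfolding n_def by linarith
    then show ?thesis using \<open>0 < c'\<close> by (simp add: field_simps)
  qed
  have n_lim: "filterlim n sequentially (at_right 0)"
  proof -
    have "filterlim (\<lambda>\<delta>. (1 / c') * B \<delta>) at_top (at_right 0)"
      using \<open>0 < c'\<close> by (intro filterlim_tendsto_pos_mult_at_top[OF tendsto_const _ budget]) simp
    then have "filterlim (\<lambda>\<delta>. real (n \<delta>)) at_top (at_right 0)"
      by (rule filterlim_at_top_mono) (auto simp: n_def intro!: always_eventually; linarith)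
    then show ?thesis
      by (simp add: filterlim_sequentially_iff_filterlim_real)
  qed
  interpret C: prob_space \<C> using cost by (simp add: cost_distribution_def)
  interpret CP: prob_space "PiM (UNIV :: nat set) (\<lambda>_. \<C>)" by (intro prob_space_PiM C.prob_space_axioms)
  have sets_C: "sets \<C> = sets borel" using cost by (simp add: cost_distribution_def)
  have p_density: "p \<theta> = density (p \<theta>') (likelihood_ratio \<theta> \<theta>')"
    by (rule member_eq_density)
  define bound where "bound \<delta> = exp (real (n \<delta>) * \<rho>) * \<delta> + exp (\<psi> - \<eta> * \<rho>) ^ n \<delta> + q ^ n \<delta>" for \<delta>
  have le_bound: "measure (joint_law (p \<theta>) \<C>) (E \<theta> \<delta>) \<le> bound \<delta>" if \<delta>: "\<delta> \<in> {0<..<1}" for \<delta>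
  proof -
    have sets_A: "A \<delta> k \<in> sets (PiM {..<k} (\<lambda>_. p \<theta>'))" for k
      using A[OF \<delta>, of k] by (simp cong: sets_PiM_cong)
    have "measure (joint_law (p \<theta>) \<C>) (E \<theta> \<delta>)
      \<le> exp (real (n \<delta>) * \<rho>) * measure (joint_law (p \<theta>') \<C>) (E \<theta>' \<delta>)
        + exp (- \<eta> * (real (n \<delta>) * \<rho>)) * exp \<psi> ^ n \<delta>
        + measure (PiM UNIV (\<lambda>_. \<C>)) {x \<in> space (PiM UNIV (\<lambda>_. \<C>)). n \<delta> < num_samples (B \<delta>) x}"
      unfolding joint_law_def E_def p_density
      using \<eta> prob_space_member[OF \<theta>(1)] prob_space_member[OF \<theta>(2)]
      by (intro random_prefix_density_le measurable_num_samples sets_C sets_A likelihood_ratio_pos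
          CP.prob_space_axioms) (auto simp flip: member_eq_density)
    also have "\<dots> \<le> exp (real (n \<delta>) * \<rho>) * \<delta> + exp (- \<eta> * (real (n \<delta>) * \<rho>)) * exp \<psi> ^ n \<delta> + q ^ n \<delta>"
      unfolding q_def
      by (intro add_mono mult_left_mono small[OF \<delta>] prob_num_samples_gt_le[OF cost s(1) n_ge]) auto
    also have "exp (- \<eta> * (real (n \<delta>) * \<rho>)) * exp \<psi> ^ n \<delta> = exp (\<psi> - \<eta> * \<rho>) ^ n \<delta>"
      by (simp add: exp_add[symmetric] algebra_simps flip: exp_of_nat_mult)
    finally show ?thesis by (simp add: bound_def)
  qed
  have "((\<lambda>\<delta>. exp (real (n \<delta>) * \<rho>) * \<delta>) \<longlongrightarrow> 0) (at_right 0)"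
  proof -
    have ln_lim: "filterlim (\<lambda>\<delta>::real. ln (1 / \<delta>)) at_top (at_right 0)"
      by (intro filterlim_compose[OF ln_at_top]) (simp add: filterlim_inverse_at_top_right divide_inverse)
    have "((\<lambda>\<delta>. B \<delta> / ln (1 / \<delta>) * (\<rho> / c') + \<rho> / ln (1 / \<delta>) - 1) \<longlongrightarrow> \<kappa> * (\<rho> / c') + 0 - 1) (at_right 0)"
      by (intro tendsto_intros rate real_tendsto_divide_at_top[OF tendsto_const ln_lim])
    moreover have "\<kappa> * (\<rho> / c') + 0 - 1 < 0"
      using c' \<open>0 < c'\<close> by (simp add: field_simps)
    ultimately have "filterlim (\<lambda>\<delta>. (B \<delta> / ln (1 / \<delta>) * (\<rho> / c') + \<rho> / ln (1 / \<delta>) - 1) * ln (1 / \<delta>)) at_bot (at_right 0)"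
      by (rule filterlim_tendsto_neg_mult_at_bot[OF _ _ ln_lim])
    then have lim: "((\<lambda>\<delta>. exp ((B \<delta> / ln (1 / \<delta>) * (\<rho> / c') + \<rho> / ln (1 / \<delta>) - 1) * ln (1 / \<delta>))) \<longlongrightarrow> 0) (at_right 0)"
      by (rule filterlim_compose[OF exp_at_bot])
    have "\<forall>\<^sub>F \<delta> in at_right 0. 0 < B \<delta>"
      using budget by (simp add: filterlim_at_top_dense)
    moreover have "\<forall>\<^sub>F \<delta> in at_right 0. (\<delta>::real) \<in> {0<..<1}"
      by (rule eventually_at_right_real) simp
    ultimately have "\<forall>\<^sub>F \<delta> in at_right 0. exp (real (n \<delta>) * \<rho>) * \<delta>
        \<le> exp ((B \<delta> / ln (1 / \<delta>) * (\<rho> / c') + \<rho> / ln (1 / \<delta>) - 1) * ln (1 / \<delta>))"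
    proof eventually_elim
      case (elim \<delta>)
      then have ln: "0 < ln (1 / \<delta>)" by simp
      have "0 < B \<delta> / c'" using elim \<open>0 < c'\<close> by simp
      then have "real (n \<delta>) \<le> B \<delta> / c' + 1" unfolding n_def by linarith
      then have "real (n \<delta>) * \<rho> - ln (1 / \<delta>) \<le> (B \<delta> / c' + 1) * \<rho> - ln (1 / \<delta>)"
        using \<rho> by simp
      also have "\<dots> = (B \<delta> / ln (1 / \<delta>) * (\<rho> / c') + \<rho> / ln (1 / \<delta>) - 1) * ln (1 / \<delta>)"
        using ln \<open>0 < c'\<close> by (simp add: field_simps del: ln_less_zero_iff)
      finally have "exp (real (n \<delta>) * \<rho> - ln (1 / \<delta>))
          \<le> exp ((B \<delta> / ln (1 / \<delta>) * (\<rho> / c') + \<rho> / ln (1 / \<delta>) - 1) * ln (1 / \<delta>))"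
        by simp
      moreover have "exp (real (n \<delta>) * \<rho> - ln (1 / \<delta>)) = exp (real (n \<delta>) * \<rho>) * \<delta>"
        using elim by (simp add: ln_div exp_add)
      ultimately show ?case by simp
    qed
    moreover have "\<forall>\<^sub>F \<delta> in at_right 0. 0 \<le> exp (real (n \<delta>) * \<rho>) * \<delta>"
      by (rule eventually_mono[OF eventually_at_right_less]) simp
    ultimately show ?thesis
      by (intro tendsto_sandwich[OF _ _ tendsto_const lim])
  qed
  moreover have "((\<lambda>\<delta>. exp (\<psi> - \<eta> * \<rho>) ^ n \<delta>) \<longlongrightarrow> 0) (at_right 0)"
    using \<eta> by (intro filterlim_compose[OF LIMSEQ_realpow_zero n_lim]) auto
  moreover have "((\<lambda>\<delta>. q ^ n \<delta>) \<longlongrightarrow> 0) (at_right 0)"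
    using q by (intro filterlim_compose[OF LIMSEQ_realpow_zero n_lim]) auto
  ultimately have "(bound \<longlongrightarrow> 0 + 0 + 0) (at_right 0)"
    unfolding bound_def[abs_def] by (intro tendsto_add)
  moreover have "\<forall>\<^sub>F \<delta> in at_right 0. measure (joint_law (p \<theta>) \<C>) (E \<theta> \<delta>) \<le> bound \<delta>"
    by (rule eventually_mono[OF eventually_at_right_real[of 0 1]]) (auto intro: le_bound)
  ultimately have "\<forall>\<^sub>F \<delta> in at_right 0. measure (joint_law (p \<theta>) \<C>) (E \<theta> \<delta>) \<le> bound \<delta>"
      "(bound \<longlongrightarrow> 0) (at_right 0)"
    by simp_all
  from tendsto_sandwich[OF _ this(1) tendsto_const this(2)] show ?thesis by simp
qed

text \<open>
  Both events are contained in the event that \<open>m\<close> is missed, which has probability at most \<open>\<delta>\<close> under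
  the member with mean \<open>m\<close>.
\<close>

lemma endpoint_beyond_mean_vanishes:
  assumes \<mu>: "\<mu> \<in> mean_range \<xi> b" "m \<in> mean_range \<xi> b"
    and cost: "cost_distribution \<C> c"
    and budget: "filterlim B at_top (at_right 0)"
    and rate: "((\<lambda>\<delta>. B \<delta> / ln (1 / \<delta>)) \<longlongrightarrow> \<kappa>) (at_right 0)" "0 \<le> \<kappa>"
    and slow: "\<kappa> * mean_divergence \<xi> b \<mu> m < c"
    and policy: "\<pi> \<in> CI_policies \<xi> b \<C> B"
    and \<nu>: "\<nu> \<in> exp_fam \<xi> b" "mean \<nu> = \<mu>"
  shows "((\<lambda>\<delta>. measure (joint_law \<nu> \<C>) {\<omega> \<in> space (joint_law \<nu> \<C>). reported_upper \<pi> B \<delta> \<omega> < ereal m})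
      \<longlongrightarrow> 0) (at_right 0)"
    and "((\<lambda>\<delta>. measure (joint_law \<nu> \<C>) {\<omega> \<in> space (joint_law \<nu> \<C>). ereal m < reported_lower \<pi> B \<delta> \<omega>})
      \<longlongrightarrow> 0) (at_right 0)"
proof -
  obtain \<theta> where \<theta>: "\<theta> \<in> \<Theta>" "\<nu> = p \<theta>" "\<mu> = deriv b \<theta>"
    using \<nu> by (auto simp: exp_fam_def mean_member)
  obtain \<theta>' where \<theta>': "\<theta>' \<in> \<Theta>" "m = deriv b \<theta>'"
    using \<mu> by (auto simp: mean_range_eq)
  have sets_C: "sets \<C> = sets borel" and prob_C: "prob_space \<C>"
    using cost by (auto simp: cost_distribution_def)
  have vanish: "((\<lambda>\<delta>. measure (joint_law \<nu> \<C>) {\<omega> \<in> space (joint_law \<nu> \<C>). R \<delta> \<omega>}) \<longlongrightarrow> 0) (at_right 0)"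
    if A: "\<And>\<delta> n. \<delta> \<in> {0<..<1} \<Longrightarrow> Measurable.pred (PiM {..<n} (\<lambda>_. borel)) (S \<delta> n)"
    and R: "\<And>\<delta> \<omega>. R \<delta> \<omega> = S \<delta> (num_samples (B \<delta>) (snd \<omega>)) (restrict (fst \<omega>) {..<num_samples (B \<delta>) (snd \<omega>)})"
    and miss: "\<And>\<delta> \<omega>. R \<delta> \<omega> \<Longrightarrow> ereal m \<notin> {reported_lower \<pi> B \<delta> \<omega>..reported_upper \<pi> B \<delta> \<omega>}"
    for R :: "real \<Rightarrow> (nat \<Rightarrow> real) \<times> (nat \<Rightarrow> real) \<Rightarrow> bool" and S
  proof -
    define A where "A \<delta> n = {x \<in> space (PiM {..<n} (\<lambda>_. borel)). S \<delta> n x}" for \<delta> n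
    have sets_A: "A \<delta> n \<in> sets (PiM {..<n} (\<lambda>_. borel))" if "\<delta> \<in> {0<..<1}" for \<delta> n
      using that(1)[THEN A, of n] unfolding A_def by measurable
    have eq: "{\<omega> \<in> space (joint_law (p t) \<C>). R \<delta> \<omega>} =
      {\<omega> \<in> space (joint_law (p t) \<C>).
        restrict (fst \<omega>) {..<num_samples (B \<delta>) (snd \<omega>)} \<in> A \<delta> (num_samples (B \<delta>) (snd \<omega>))}" for t \<delta>
      by (auto simp: R A_def space_PiM)
    show ?thesis
      unfolding \<theta>(2) eq
    proof (rule prefix_event_vanishes[OF \<theta>(1) \<theta>'(1) cost budget rate _ sets_A])
      show "\<kappa> * mean_divergence \<xi> b (deriv b \<theta>) (deriv b \<theta>') < c"
        using slow \<theta> \<theta>' by simp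
    next
      fix \<delta> :: real assume \<delta>: "\<delta> \<in> {0<..<1}"
      let ?J = "joint_law (p \<theta>') \<C>"
      interpret J: prob_space ?J by (intro prob_space_joint_law prob_space_member \<theta>' prob_C)
      let ?E = "{\<omega> \<in> space ?J. R \<delta> \<omega>}"
      let ?CI = "{\<omega> \<in> space ?J. ereal m \<in> {reported_lower \<pi> B \<delta> \<omega>..reported_upper \<pi> B \<delta> \<omega>}}"
      have "1 - \<delta> \<le> J.prob ?CI"
        using policy \<delta> \<theta>' by (auto simp: CI_policies_def exp_fam_def mean_member)
      \<comment> \<open>\<open>measure\<close> is 0 on non-measurable sets, so the coverage guarantee itself yields measurability.\<close>
      moreover have "?CI \<in> J.events"
        using \<delta> calculation measure_notin_sets[of ?CI ?J] by (cases "?CI \<in> J.events") simp_all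
      moreover have "?E \<in> J.events"
        unfolding eq unfolding joint_law_def
        using sets_A[OF \<delta>]
        by (intro emeasure_pair_PiM_prefix(2) prob_space_member \<theta>' prob_space_PiM prob_C
            measurable_num_samples sets_C) (simp cong: sets_PiM_cong)
      moreover have "?E \<inter> ?CI = {}" using miss by auto
      ultimately have "J.prob ?E + (1 - \<delta>) \<le> J.prob (?E \<union> ?CI)"
        by (simp add: J.finite_measure_Union)
      then have "J.prob ?E \<le> \<delta>"
        using J.prob_le_1[of "?E \<union> ?CI"] by linarith
      then show "J.prob {\<omega> \<in> space ?J.
        restrict (fst \<omega>) {..<num_samples (B \<delta>) (snd \<omega>)} \<in> A \<delta> (num_samples (B \<delta>) (snd \<omega>))} \<le> \<delta>"
        unfolding eq .
    qed
  qed
  have [measurable]: "lower_end \<pi> n \<delta> \<in> borel_measurable (PiM {..<n} (\<lambda>_. borel))"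
    "upper_end \<pi> n \<delta> \<in> borel_measurable (PiM {..<n} (\<lambda>_. borel))" if "\<delta> \<in> {0<..<1}" for n \<delta>
    using policy that by (auto simp: CI_policies_def measurable_policy_def)
  show "((\<lambda>\<delta>. measure (joint_law \<nu> \<C>) {\<omega> \<in> space (joint_law \<nu> \<C>). reported_upper \<pi> B \<delta> \<omega> < ereal m})
      \<longlongrightarrow> 0) (at_right 0)"
    by (rule vanish[where S="\<lambda>\<delta> n x. upper_end \<pi> n \<delta> x < ereal m"])
       (auto simp: reported_upper_def Let_def)
  show "((\<lambda>\<delta>. measure (joint_law \<nu> \<C>) {\<omega> \<in> space (joint_law \<nu> \<C>). ereal m < reported_lower \<pi> B \<delta> \<omega>})
      \<longlongrightarrow> 0) (at_right 0)"
    by (rule vanish[where S="\<lambda>\<delta> n x. ereal m < lower_end \<pi> n \<delta> x"])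
       (auto simp: reported_lower_def Let_def)
qed

end

section \<open>Limits in probability of the endpoints\<close>

lemma tendsto_in_prob_not_vanishing:
  assumes "tendsto_in_prob M Y l" "open U" "l \<in> U"
  shows "\<not> ((\<lambda>\<delta>. measure M {\<omega> \<in> space M. Y \<delta> \<omega> \<in> U}) \<longlongrightarrow> 0) (at_right 0)"
proof
  assume "((\<lambda>\<delta>. measure M {\<omega> \<in> space M. Y \<delta> \<omega> \<in> U}) \<longlongrightarrow> 0) (at_right 0)"
  moreover have "((\<lambda>\<delta>. measure M {\<omega> \<in> space M. Y \<delta> \<omega> \<in> U}) \<longlongrightarrow> 1) (at_right 0)"
    using assms by (simp add: tendsto_in_prob_def)
  ultimately have "(0::real) = 1"
    by (rule tendsto_unique[OF trivial_limit_at_right_real])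
  then show False by simp
qed

lemma tendsto_in_prob_ge:
  assumes "tendsto_in_prob M Y l"
    and "((\<lambda>\<delta>. measure M {\<omega> \<in> space M. Y \<delta> \<omega> < a}) \<longlongrightarrow> 0) (at_right 0)"
  shows "a \<le> l"
  using tendsto_in_prob_not_vanishing[OF assms(1), of "{..<a}"] assms(2) by (auto simp: not_le[symmetric])

lemma tendsto_in_prob_le:
  assumes "tendsto_in_prob M Y l"
    and "((\<lambda>\<delta>. measure M {\<omega> \<in> space M. a < Y \<delta> \<omega>}) \<longlongrightarrow> 0) (at_right 0)"
  shows "l \<le> a"
  using tendsto_in_prob_not_vanishing[OF assms(1), of "{a<..}"] assms(2) by (auto simp: not_le[symmetric])

text \<open>
  Endpoints confined to \<open>[lo, hi]\<close> have their limits there; together with the opposite inequalities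
  this determines the limits in the regime without learning.
\<close>

lemma
  assumes "reports_within lo hi \<pi>"
  shows reported_lower_limit_ge: "tendsto_in_prob M (reported_lower \<pi> B) l \<Longrightarrow> lo \<le> l"
    and reported_upper_limit_le: "tendsto_in_prob M (reported_upper \<pi> B) l \<Longrightarrow> l \<le> hi"
proof -
  have unit: "\<forall>\<^sub>F \<delta> in at_right 0. (\<delta>::real) \<in> {0<..<1}"
    by (rule eventually_at_right_real) simp
  have lo: "lo \<le> reported_lower \<pi> B \<delta> \<omega>" and hi: "reported_upper \<pi> B \<delta> \<omega> \<le> hi"
    if "\<delta> \<in> {0<..<1}" for \<delta> \<omega>
    using assms that by (auto simp: reports_within_def reported_lower_def reported_upper_def Let_def)
  have "((\<lambda>\<delta>. measure M {\<omega> \<in> space M. reported_lower \<pi> B \<delta> \<omega> < lo}) \<longlongrightarrow> 0) (at_right 0)"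
  proof (rule tendsto_eventually, use unit in eventually_elim)
    case (elim \<delta>)
    then have "{\<omega> \<in> space M. reported_lower \<pi> B \<delta> \<omega> < lo} = {}"
      using lo by (auto simp: not_less)
    then show ?case by (simp only: measure_empty)
  qed
  then show "lo \<le> l" if "tendsto_in_prob M (reported_lower \<pi> B) l"
    by (rule tendsto_in_prob_ge[OF that])
  have "((\<lambda>\<delta>. measure M {\<omega> \<in> space M. hi < reported_upper \<pi> B \<delta> \<omega>}) \<longlongrightarrow> 0) (at_right 0)"
  proof (rule tendsto_eventually, use unit in eventually_elim)
    case (elim \<delta>)
    then have "{\<omega> \<in> space M. hi < reported_upper \<pi> B \<delta> \<omega>} = {}"
      using hi by (auto simp: not_less)
    then show ?case by (simp only: measure_empty)
  qed
  then show "l \<le> hi" if "tendsto_in_prob M (reported_upper \<pi> B) l"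
    by (rule tendsto_in_prob_le[OF that])
qed

section \<open>The learning regimes\<close>

theorem theorem3:
  fixes \<xi> \<nu> \<C> :: "real measure"
    and b B :: "real \<Rightarrow> real"
    and \<mu> c :: real
    and lo hi \<mu>L \<mu>R :: ereal
    and \<pi> :: policy
  assumes family: "exponential_family \<xi> b"
    and range: "mean_range \<xi> b = {m. lo < ereal m \<and> ereal m < hi}"
    and \<nu>: "\<nu> \<in> exp_fam \<xi> b" "mean \<nu> = \<mu>"
    and cost: "cost_distribution \<C> c" "0 < c"
    and budget: "filterlim B at_top (at_right 0)"
    and policy: "\<pi> \<in> CI_policies \<xi> b \<C> B"
    and stable: "stable_policy \<nu> \<C> B \<pi> \<mu>L \<mu>R"
  shows
    "(((\<lambda>\<delta>. B \<delta> / ln (1 / \<delta>)) \<longlongrightarrow> 0) (at_right 0) \<longrightarrow>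
        \<mu>L \<le> lo \<and> hi \<le> \<mu>R \<and>
        (reports_within lo hi \<pi> \<longrightarrow>
           \<mu>R - \<mu>L = hi - lo \<and>
           tendsto_in_prob (joint_law \<nu> \<C>) (reported_lower \<pi> B) lo \<and>
           tendsto_in_prob (joint_law \<nu> \<C>) (reported_upper \<pi> B) hi)) \<and>
     (\<forall>k>0. ((\<lambda>\<delta>. B \<delta> / ln (1 / \<delta>)) \<longlongrightarrow> k) (at_right 0) \<longrightarrow>
        ((\<exists>m\<in>mean_range \<xi> b. m < \<mu> \<and> c / k \<le> mean_divergence \<xi> b \<mu> m) \<longrightarrow>
           (\<exists>!l. solves_left \<xi> b \<mu> k c l)) \<and>
        ((\<exists>m\<in>mean_range \<xi> b. \<mu> < m \<and> c / k \<le> mean_divergence \<xi> b \<mu> m) \<longrightarrow>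
           (\<exists>!r. solves_right \<xi> b \<mu> k c r)) \<and>
        \<mu>R - \<mu>L \<ge> right_star \<xi> b \<mu> k c - left_star \<xi> b \<mu> k c)"
proof -
  interpret one_parameter_family \<xi> b by standard (rule family)
  have \<mu>: "\<mu> \<in> mean_range \<xi> b" using \<nu> by (auto simp: mean_range_def)
  then have \<mu>_range: "lo < ereal \<mu>" "ereal \<mu> < hi" by (auto simp: range)
  have in_range: "m \<in> mean_range \<xi> b"
    if "lo < ereal m \<and> m < \<mu> \<or> \<mu> < m \<and> ereal m < hi" for m
    using that less_trans[OF \<mu>_range(1), of "ereal m"] less_trans[OF _ \<mu>_range(2), of "ereal m"]
    by (auto simp: range)
  have lim: "tendsto_in_prob (joint_law \<nu> \<C>) (reported_lower \<pi> B) \<mu>L"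
    "tendsto_in_prob (joint_law \<nu> \<C>) (reported_upper \<pi> B) \<mu>R" 
    and around: "\<mu>L \<le> ereal \<mu>" "ereal \<mu> \<le> \<mu>R"
    using stable \<nu> by (auto simp: stable_policy_def)
  \<comment> \<open>The information bound: means that are too close to \<open>\<mu>\<close> for the budget cannot be excluded in the limit.\<close>
  have enclosed: "\<mu>L \<le> ereal m" "ereal m \<le> \<mu>R"
    if "((\<lambda>\<delta>. B \<delta> / ln (1 / \<delta>)) \<longlongrightarrow> \<kappa>) (at_right 0)" "0 \<le> \<kappa>"
      "m \<in> mean_range \<xi> b" "\<kappa> * mean_divergence \<xi> b \<mu> m < c" for \<kappa> m
  proof -
    note rare = endpoint_beyond_mean_vanishes[OF \<mu> that(3) cost(1) budget that(1,2,4) policy \<nu>]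
    show "\<mu>L \<le> ereal m" by (rule tendsto_in_prob_le[OF lim(1) rare(2)])
    show "ereal m \<le> \<mu>R" by (rule tendsto_in_prob_ge[OF lim(2) rare(1)])
  qed
  show ?thesis
  proof (intro conjI impI allI)
    assume rate: "((\<lambda>\<delta>. B \<delta> / ln (1 / \<delta>)) \<longlongrightarrow> 0) (at_right 0)"
    have all: "\<mu>L \<le> ereal m \<and> ereal m \<le> \<mu>R" if "m \<in> mean_range \<xi> b" for m
      using enclosed[OF rate _ that] cost(2) by auto
    show L: "\<mu>L \<le> lo"
    proof (rule ccontr)
      assume "\<not> \<mu>L \<le> lo"
      then have "lo < min \<mu>L (ereal \<mu>)" using \<mu>_range by simp
      then obtain m where "lo < ereal m" "ereal m < min \<mu>L (ereal \<mu>)"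
        using ereal_dense2[of lo "min \<mu>L (ereal \<mu>)"] by auto
      moreover from this have "m \<in> mean_range \<xi> b" by (intro in_range) auto
      ultimately show False using all[of m] by auto
    qed
    show R: "hi \<le> \<mu>R"
    proof (rule ccontr)
      assume "\<not> hi \<le> \<mu>R"
      then have "max \<mu>R (ereal \<mu>) < hi" using \<mu>_range by simp
      then obtain m where "max \<mu>R (ereal \<mu>) < ereal m" "ereal m < hi"
        using ereal_dense2[of "max \<mu>R (ereal \<mu>)" hi] by auto
      moreover from this have "m \<in> mean_range \<xi> b" by (intro in_range) auto
      ultimately show False using all[of m] by auto
    qed
    assume within: "reports_within lo hi \<pi>"
    have "\<mu>L = lo" "\<mu>R = hi"
      using L R reported_lower_limit_ge[OF within lim(1)] reported_upper_limit_le[OF within lim(2)] by auto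
    then show "\<mu>R - \<mu>L = hi - lo"
      "tendsto_in_prob (joint_law \<nu> \<C>) (reported_lower \<pi> B) lo"
      "tendsto_in_prob (joint_law \<nu> \<C>) (reported_upper \<pi> B) hi"
      using lim by auto
  next
    fix k :: real assume k: "0 < k" and rate: "((\<lambda>\<delta>. B \<delta> / ln (1 / \<delta>)) \<longlongrightarrow> k) (at_right 0)"
    have ck: "0 < c / k" using k cost by simp
    show "\<exists>!l. solves_left \<xi> b \<mu> k c l"
      if "\<exists>m\<in>mean_range \<xi> b. m < \<mu> \<and> c / k \<le> mean_divergence \<xi> b \<mu> m"
    proof -
      from that obtain m where "m \<in> mean_range \<xi> b" "m < \<mu>" "c / k \<le> mean_divergence \<xi> b \<mu> m"
        by blast
      then show ?thesis
        by (intro ex1_solves_left[OF \<mu> _ _ ck])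
    qed
    show "\<exists>!r. solves_right \<xi> b \<mu> k c r"
      if "\<exists>m\<in>mean_range \<xi> b. \<mu> < m \<and> c / k \<le> mean_divergence \<xi> b \<mu> m"
    proof -
      from that obtain m where "m \<in> mean_range \<xi> b" "\<mu> < m" "c / k \<le> mean_divergence \<xi> b \<mu> m"
        by blast
      then show ?thesis
        by (intro ex1_solves_right[OF \<mu> _ _ ck])
    qed
    have close: "\<mu>L \<le> ereal m \<and> ereal m \<le> \<mu>R"
      if "m \<in> mean_range \<xi> b" "mean_divergence \<xi> b \<mu> m < c / k" for m
    proof -
      have "k * mean_divergence \<xi> b \<mu> m < c"
        using that(2) k by (simp add: field_simps)
      then show ?thesis
        using enclosed[OF rate less_imp_le[OF k] that(1)] by simp
    qed
    show "right_star \<xi> b \<mu> k c - left_star \<xi> b \<mu> k c \<le> \<mu>R - \<mu>L"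
    proof (rule ereal_minus_mono)
      show "right_star \<xi> b \<mu> k c \<le> \<mu>R"
        by (rule right_star_least[OF \<mu> ck around(2)]) (simp add: close)
      show "\<mu>L \<le> left_star \<xi> b \<mu> k c"
        by (rule left_star_greatest[OF \<mu> ck around(1)]) (simp add: close)
    qed
  qed
qed

end
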